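(* Let $\Psi$ be a quantum operation with respect to the Hilbert space $\mathcal{H}$ and let $A\in\mathcal{B}(\mathcal{H})$. The following assertions are equivalent: (i) $[L_A,\Psi]=0$. (ii) $A$ and $A^*A$ are constants of $\Psi$. (iii) $[R_A,\Psi^\sharp]=0$. (iv) $A$ and $A^*A$ are fixed points of $\Psi^\sharp$.
   Context: $\mathcal{B}(\mathcal{H})$ is the algebra of bounded operators on $\mathcal{H}$ and $\mathcal{B}_1(\mathcal{H})$ the trace class. A quantum operation is a completely positive, trace-preserving linear map $\Psi\colon\mathcal{B}_1(\mathcal{H})\to\mathcal{B}_1(\mathcal{H})$; its dual $\Psi^\sharp\colon\mathcal{B}(\mathcal{H})\to\mathcal{B}(\mathcal{H})$ is defined by $\operatorname{tr}(\Psi(T)S)=\operatorname{tr}(T\Psi^\sharp(S))$ for $T\in\mathcal{B}_1(\mathcal{H})$, $S\in\mathcal{B}(\mathcal{H})$. $L_A(T)=AT$ and $R_A(T)=TA$, regarded as operators on $\mathcal{B}_1(\mathcal{H})$ or on $\mathcal{B}(\mathcal{H})$ according to context, and $[\Phi,\Psi]=\Phi\Psi-\Psi\Phi$. States (density operators) are the positive $\rho\in\mathcal{B}_1(\mathcal{H})$ with $\operatorname{tr}(\rho)=1$. An operator $B\in\mathcal{B}(\mathcal{H})$ is a constant of $\Psi$ (equivalently, of the discrete quantum semigroup $\{\Psi^n\}_{n\ge0}$) if for every state $\rho$ the number $\operatorname{tr}(\Psi^n(\rho)B)$ does not depend on the integer $n\ge0$. *)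

theory Defs
  imports "HOL-Analysis.Analysis"
begin

section \<open>Complex Hilbert spaces\<close>

class complex_vector = real_vector +
  fixes scaleC :: "complex \<Rightarrow> 'a \<Rightarrow> 'a"  (infixr \<open>*\<^sub>C\<close> 75)
  assumes scaleC_add_right: "c *\<^sub>C (x + y) = c *\<^sub>C x + c *\<^sub>C y"
    and scaleC_add_left: "(c + d) *\<^sub>C x = c *\<^sub>C x + d *\<^sub>C x"
    and scaleC_scaleC: "c *\<^sub>C d *\<^sub>C x = (c * d) *\<^sub>C x"
    and scaleR_scaleC: "r *\<^sub>R x = complex_of_real r *\<^sub>C x"

text \<open>
  The inner product is linear in the second argument. Its positive definiteness, and the
  identity \<open>norm x = sqrt (Re (cinner x x))\<close>, come from \<^class>\<open>real_inner\<close>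
  through the last axiom.
\<close>

class complex_inner = complex_vector + real_inner +
  fixes cinner :: "'a \<Rightarrow> 'a \<Rightarrow> complex"
  assumes cinner_commute: "cinner x y = cnj (cinner y x)"
    and cinner_add_right: "cinner x (y + z) = cinner x y + cinner x z"
    and cinner_scaleC_right: "cinner x (c *\<^sub>C y) = c * cinner x y"
    and inner_eq_Re_cinner: "inner x y = Re (cinner x y)"

class chilbert_space = complex_inner + complete_space

instantiation complex :: chilbert_space
begin

definition scaleC_complex :: "complex \<Rightarrow> complex \<Rightarrow> complex"
  where "scaleC_complex c x = c * x"

definition cinner_complex :: "complex \<Rightarrow> complex \<Rightarrow> complex"
  where "cinner_complex x y = cnj x * y"

instance
  by standard
    (auto simp: scaleC_complex_def cinner_complex_def inner_complex_def algebra_simps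
      scaleR_conv_of_real)

end

lemma cinner_self: "cinner x x = complex_of_real ((norm x)\<^sup>2)"
proof -
  have "Im (cinner x x) = 0"
    using arg_cong[OF cinner_commute[of x x], of Im] by simp
  then show ?thesis
    by (simp add: complex_eq_iff power2_norm_eq_inner inner_eq_Re_cinner)
qed

lemma norm_scaleC: "norm (c *\<^sub>C x) = norm c * norm (x :: 'a :: complex_inner)"
proof -
  have "cinner (c *\<^sub>C x) (c *\<^sub>C x) = c * cnj c * cinner x x"
    by (metis (no_types, lifting) cinner_commute cinner_scaleC_right complex_cnj_mult mult.assoc)
  then have "(norm (c *\<^sub>C x))\<^sup>2 = (norm c * norm x)\<^sup>2"
    unfolding cinner_self complex_norm_square[symmetric] power_mult_distrib
    by (metis of_real_eq_iff of_real_mult)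
  then show ?thesis
    by (simp add: power2_eq_iff_nonneg)
qed

lemma bounded_linear_scaleC_right:
  "bounded_linear (\<lambda>x :: 'a :: complex_inner. c *\<^sub>C x)"
proof (rule bounded_linear_intro[where K = "norm c"])
  show "c *\<^sub>C (r *\<^sub>R x) = r *\<^sub>R (c *\<^sub>C x)" for r and x :: 'a
    by (simp add: scaleR_scaleC scaleC_scaleC mult.commute)
qed (simp_all add: scaleC_add_right norm_scaleC mult.commute)


section \<open>Bounded operators\<close>

instantiation blinfun :: (real_normed_vector, complex_inner) complex_vector
begin

lift_definition scaleC_blinfun :: "complex \<Rightarrow> ('a \<Rightarrow>\<^sub>L 'b) \<Rightarrow> ('a \<Rightarrow>\<^sub>L 'b)"
  is "\<lambda>c T x. c *\<^sub>C T x"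
  by (rule bounded_linear_compose[OF bounded_linear_scaleC_right])

instance
  by standard
    (transfer, simp add: scaleC_add_right scaleC_add_left scaleC_scaleC scaleR_scaleC fun_eq_iff)+

end

type_synonym 'h operator = "'h \<Rightarrow>\<^sub>L 'h"

text \<open>
  The type \<^typ>\<open>'h operator\<close> contains all real-linear bounded operators; the algebra
  of bounded operators in the Hilbert space sense consists of the complex-linear ones.
\<close>

definition bounded_ops :: "'h::chilbert_space operator set"
  where "bounded_ops =
    {A. \<forall>c x. blinfun_apply A (c *\<^sub>C x) = c *\<^sub>C blinfun_apply A x}"

definition adjoint_op :: "'h::chilbert_space operator \<Rightarrow> 'h operator"
  where "adjoint_op A =
    (THE B. B \<in> bounded_ops \<and>
      (\<forall>x y. cinner (blinfun_apply B x) y = cinner x (blinfun_apply A y)))"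

definition positive_op :: "'h::chilbert_space operator \<Rightarrow> bool"
  where "positive_op P \<longleftrightarrow>
    P \<in> bounded_ops \<and> (\<forall>x. cinner x (blinfun_apply P x) \<in> \<real>\<^sub>\<ge>\<^sub>0)"

definition abs_op :: "'h::chilbert_space operator \<Rightarrow> 'h operator"
  where "abs_op T = (THE P. positive_op P \<and> P o\<^sub>L P = adjoint_op T o\<^sub>L T)"


section \<open>Trace class\<close>

text \<open>A Hilbert basis, as a maximal orthonormal set.\<close>

definition onb :: "'h::chilbert_space set \<Rightarrow> bool"
  where "onb E \<longleftrightarrow>
    (\<forall>e\<in>E. norm e = 1) \<and>
    (\<forall>e\<in>E. \<forall>f\<in>E. e \<noteq> f \<longrightarrow> cinner e f = 0) \<and>
    (\<forall>x. (\<forall>e\<in>E. cinner e x = 0) \<longrightarrow> x = 0)"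

definition trace_class :: "'h::chilbert_space operator set"
  where "trace_class =
    {T \<in> bounded_ops.
      \<exists>E. onb E \<and> (\<lambda>e. cinner e (blinfun_apply (abs_op T) e)) summable_on E}"

text \<open>For trace class operators the value does not depend on the chosen Hilbert basis.\<close>

definition trace :: "'h::chilbert_space operator \<Rightarrow> complex"
  where "trace T = (\<Sum>\<^sub>\<infinity>e\<in>(SOME E. onb E). cinner e (blinfun_apply T e))"

definition state :: "'h::chilbert_space operator \<Rightarrow> bool"
  where "state \<rho> \<longleftrightarrow> \<rho> \<in> trace_class \<and> positive_op \<rho> \<and> trace \<rho> = 1"


section \<open>Quantum operations\<close>

text \<open>
  Superoperators are functions on \<^typ>\<open>'h operator\<close>; only their values on
  \<^const>\<open>trace_class\<close>, respectively \<^const>\<open>bounded_ops\<close>, matter.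
\<close>

text \<open>
  Positivity of the operator matrix \<open>(T i j)\<close>, \<open>i, j < n\<close>, acting on the
  direct sum of \<open>n\<close> copies of the Hilbert space.
\<close>

definition positive_matrix :: "nat \<Rightarrow> (nat \<Rightarrow> nat \<Rightarrow> 'h::chilbert_space operator) \<Rightarrow> bool"
  where "positive_matrix n T \<longleftrightarrow>
    (\<forall>x :: nat \<Rightarrow> 'h. (\<Sum>i<n. \<Sum>j<n. cinner (x i) (blinfun_apply (T i j) (x j))) \<in> \<real>\<^sub>\<ge>\<^sub>0)"

definition completely_positive ::
    "('h::chilbert_space operator \<Rightarrow> 'h operator) \<Rightarrow> bool"
  where "completely_positive \<Psi> \<longleftrightarrow>
    (\<forall>n T. (\<forall>i<n. \<forall>j<n. T i j \<in> trace_class) \<longrightarrow> positive_matrix n T \<longrightarrow>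
      positive_matrix n (\<lambda>i j. \<Psi> (T i j)))"

definition quantum_operation ::
    "('h::chilbert_space operator \<Rightarrow> 'h operator) \<Rightarrow> bool"
  where "quantum_operation \<Psi> \<longleftrightarrow>
    (\<forall>T\<in>trace_class. \<Psi> T \<in> trace_class) \<and>
    (\<forall>S\<in>trace_class. \<forall>T\<in>trace_class. \<Psi> (S + T) = \<Psi> S + \<Psi> T) \<and>
    (\<forall>c. \<forall>T\<in>trace_class. \<Psi> (c *\<^sub>C T) = c *\<^sub>C \<Psi> T) \<and>
    completely_positive \<Psi> \<and>
    (\<forall>T\<in>trace_class. trace (\<Psi> T) = trace T)"

definition dual_map ::
    "('h::chilbert_space operator \<Rightarrow> 'h operator) \<Rightarrow> 'h operator \<Rightarrow> 'h operator"
  where "dual_map \<Psi> S =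
    (THE R. R \<in> bounded_ops \<and> (\<forall>T\<in>trace_class. trace (\<Psi> T o\<^sub>L S) = trace (T o\<^sub>L R)))"

definition left_mult :: "'h::chilbert_space operator \<Rightarrow> 'h operator \<Rightarrow> 'h operator"
  where "left_mult A T = A o\<^sub>L T"

definition right_mult :: "'h::chilbert_space operator \<Rightarrow> 'h operator \<Rightarrow> 'h operator"
  where "right_mult A T = T o\<^sub>L A"

definition commutator ::
    "('h::chilbert_space operator \<Rightarrow> 'h operator) \<Rightarrow> ('h operator \<Rightarrow> 'h operator) \<Rightarrow>
      'h operator \<Rightarrow> 'h operator"
  where "commutator \<Phi> \<Psi> T = \<Phi> (\<Psi> T) - \<Psi> (\<Phi> T)"

definition constant_of ::
    "('h::chilbert_space operator \<Rightarrow> 'h operator) \<Rightarrow> 'h operator \<Rightarrow> bool"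
  where "constant_of \<Psi> B \<longleftrightarrow>
    (\<forall>\<rho>. state \<rho> \<longrightarrow>
      (\<forall>m n. trace ((\<Psi> ^^ m) \<rho> o\<^sub>L B) = trace ((\<Psi> ^^ n) \<rho> o\<^sub>L B)))"

end

theory Submission
  imports Defs
begin

text \<open>
  Everything is read off from the dual map \<open>\<Psi>\<^sup>\<sharp>\<close>. The trace pairing of trace class and bounded
  operators is nondegenerate, and the trace is cyclic, so \<open>[L\<^sub>A, \<Psi>] = 0\<close> and
  \<open>[R\<^sub>A, \<Psi>\<^sup>\<sharp>] = 0\<close> are the same identity paired with \<open>S\<close> and with \<open>T\<close>
  (\<open>left_commutes_iff_right_dual_commutes\<close>). Testing on pure states shows that the constants of
  \<open>\<Psi>\<close> are the fixed points of \<open>\<Psi>\<^sup>\<sharp>\<close> (\<open>constant_of_iff_fixed\<close>). If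
  \<open>\<Psi>\<^sup>\<sharp>(S A) = \<Psi>\<^sup>\<sharp>(S) A\<close> for all \<open>S\<close>, then \<open>S = 1\<close> and \<open>S = A\<^sup>*\<close> give the two fixed points.
  Conversely, if \<open>A\<close> and \<open>A\<^sup>* A\<close> are fixed, then \<open>\<Psi>\<^sup>\<sharp>(A\<^sup>* A) = \<Psi>\<^sup>\<sharp>(A)\<^sup>* \<Psi>\<^sup>\<sharp>(A)\<close>: equality holds in the
  Schwarz inequality for the unital completely positive map \<open>\<Psi>\<^sup>\<sharp>\<close>, and Choi's argument on the
  multiplicative domain yields \<open>\<Psi>\<^sup>\<sharp>(B A) = \<Psi>\<^sup>\<sharp>(B) A\<close> for every \<open>B\<close>
  (\<open>dual_map_multiplicative_domain\<close>).

  The existence of \<open>\<Psi>\<^sup>\<sharp>\<close> carries the analysis. For positive \<open>T\<close> the functional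
  \<open>T \<mapsto> tr (\<Psi>(T) S)\<close> is bounded by \<open>\<parallel>S\<parallel> tr T\<close>, since \<open>\<Psi>\<close> preserves positivity and trace. On
  rank-one operators it is therefore a bounded sesquilinear form, which is represented by an
  operator \<open>\<Psi>\<^sup>\<sharp>(S)\<close>; the same bound extends the formula to all trace class operators, because a
  positive trace class operator dominates finite-rank operators whose traces exhaust its trace
  (\<open>trace_class_functional_zero\<close>).

  The trace itself is handled through Hilbert--Schmidt operators. The trace class consists of the
  products \<open>B\<^sup>* C\<close> of two such operators (\<open>trace_class_factor\<close>, \<open>trace_class_product\<close>), and the trace
  of a product is the Hilbert--Schmidt pairing, whose basis independence and symmetry are one
  exchange of summations (\<open>hilbert_schmidt_pairing_swap\<close>). The factorization rests on the positive
  square root and on the polar decomposition. In these, as for adjoints and Hilbert bases, the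
  completeness of the space enters through Riesz' theorem (\<open>riesz_subspace\<close>) or norm convergence.
\<close>

text \<open>
  This makes the completeness of the space of bounded operators available, which the square root
  iteration needs.
\<close>
instance chilbert_space \<subseteq> banach ..

section \<open>Complex inner products\<close>

lemma cinner_add_left: "cinner (x + y) z = cinner x z + cinner y z"
  by (metis cinner_add_right cinner_commute complex_cnj_add)

lemma cinner_scaleC_left: "cinner (c *\<^sub>C x) y = cnj c * cinner x y"
  by (metis cinner_commute cinner_scaleC_right complex_cnj_mult)

lemma scaleC_one [simp]: "1 *\<^sub>C (x :: 'a::complex_vector) = x"
  using scaleR_scaleC[of 1 x] by simp

lemma scaleC_zero_left [simp]: "0 *\<^sub>C (x :: 'a::complex_vector) = 0"
  using scaleR_scaleC[of 0 x] by simp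

lemma scaleC_zero_right [simp]: "c *\<^sub>C (0 :: 'a::complex_vector) = 0"
  using scaleC_add_right[of c 0 "0::'a"] by simp

lemma scaleC_minus_one: "(-1) *\<^sub>C (x :: 'a::complex_vector) = - x"
  using scaleR_scaleC[of "-1" x] by simp

lemma scaleC_minus_right [simp]: "c *\<^sub>C (- x :: 'a::complex_vector) = - (c *\<^sub>C x)"
  by (metis add.inverse_unique scaleC_add_right scaleC_zero_right add.right_inverse)

lemma scaleC_diff_right: "c *\<^sub>C (x - y :: 'a::complex_vector) = c *\<^sub>C x - c *\<^sub>C y"
  using scaleC_add_right[of c x "- y"] by simp

lemma scaleC_scaleR: "c *\<^sub>C (r *\<^sub>R (x :: 'a::complex_vector)) = r *\<^sub>R (c *\<^sub>C x)"
  by (simp add: scaleR_scaleC scaleC_scaleC mult.commute)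

lemma cinner_scaleR_right: "cinner x (r *\<^sub>R y) = of_real r * cinner x y"
  by (simp add: scaleR_scaleC cinner_scaleC_right)

lemma cinner_scaleR_left: "cinner (r *\<^sub>R x) y = of_real r * cinner x y"
  by (simp add: scaleR_scaleC cinner_scaleC_left)

lemma cinner_zero_right [simp]: "cinner x 0 = 0"
  using cinner_scaleR_right[of x 0 0] by simp

lemma cinner_zero_left [simp]: "cinner 0 x = 0"
  using cinner_scaleR_left[of 0 0 x] by simp

lemma cinner_minus_right [simp]: "cinner x (- y) = - cinner x y"
  using cinner_scaleR_right[of x "-1" y] by simp

lemma cinner_minus_left [simp]: "cinner (- x) y = - cinner x y"
  using cinner_scaleR_left[of "-1" x y] by simp

lemma cinner_diff_right: "cinner x (y - z) = cinner x y - cinner x z"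
  using cinner_add_right[of x y "- z"] by simp

lemma cinner_diff_left: "cinner (x - y) z = cinner x z - cinner y z"
  using cinner_add_left[of x "- y" z] by simp

lemma cinner_sum_right: "cinner x (sum f S) = (\<Sum>i\<in>S. cinner x (f i))"
  by (induction S rule: infinite_finite_induct) (simp_all add: cinner_add_right)

lemma cinner_sum_left: "cinner (sum f S) x = (\<Sum>i\<in>S. cinner (f i) x)"
  by (induction S rule: infinite_finite_induct) (simp_all add: cinner_add_left)

lemmas cinner_simps = cinner_add_left cinner_add_right cinner_diff_left cinner_diff_right
  cinner_scaleC_left cinner_scaleC_right

lemma Im_cinner: "Im (cinner x y) = inner (\<i> *\<^sub>C x) y"
  by (simp add: inner_eq_Re_cinner cinner_scaleC_left)

text \<open>
  The real part of a complex inner product determines it: the imaginary part is the real part after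
  multiplying the first argument by \<open>\<i>\<close>.
\<close>
lemma cinner_eqI: "(\<And>y. inner y u = Re (z y)) \<Longrightarrow> (\<And>y. z (\<i> *\<^sub>C y) = - \<i> * z y) \<Longrightarrow> cinner y u = z y"
  by (simp add: complex_eq_iff Im_cinner flip: inner_eq_Re_cinner)

lemma cinner_ext: "(\<And>x. cinner x u = cinner x v) \<Longrightarrow> u = v"
  by (metis cinner_diff_right cinner_self eq_iff_diff_eq_0 norm_eq_zero of_real_eq_0_iff
      power_eq_0_iff)

lemma Cauchy_Schwarz_cinner: "norm (cinner x y) \<le> norm x * norm y"
proof (cases "cinner x y = 0")
  case False
  \<comment> \<open>rotating \<open>x\<close> by the phase of \<open>\<langle>x, y\<rangle>\<close> makes the complex inner product real\<close>
  define c where "c = cinner x y / norm (cinner x y)"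
  have c: "norm c = 1" using False by (simp add: c_def norm_divide)
  have "cnj (cinner x y) * cinner x y = of_real (norm (cinner x y))^2"
    by (metis complex_norm_square mult.commute of_real_power)
  then have "cinner (c *\<^sub>C x) y = of_real (norm (cinner x y))"
    using False by (simp add: c_def cinner_scaleC_left power2_eq_square field_simps)
  then have "norm (cinner x y) = inner (c *\<^sub>C x) y"
    by (simp add: inner_eq_Re_cinner)
  also have "\<dots> \<le> norm x * norm y"
    using norm_cauchy_schwarz[of "c *\<^sub>C x" y] c by (simp add: norm_scaleC)
  finally show ?thesis .
qed simp

lemma cinner_self_Re: "Re (cinner x x) = (norm x)\<^sup>2"
  by (simp add: cinner_self)

lemma bounded_linear_cinner_right: "bounded_linear (\<lambda>y. cinner x y)"
  by (rule bounded_linear_intro[where K = "norm x"])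
    (simp_all add: cinner_add_right cinner_scaleR_right scaleR_conv_of_real
      Cauchy_Schwarz_cinner mult.commute[of _ "norm x"])

lemma bounded_linear_cinner_left: "bounded_linear (\<lambda>x. cinner x y)"
  by (rule bounded_linear_intro[where K = "norm y"])
    (simp_all add: cinner_add_left cinner_scaleR_left scaleR_conv_of_real
      Cauchy_Schwarz_cinner)

section \<open>The Riesz representation theorem\<close>

text \<open>
  A quadratic without constant term takes negative values near \<open>0\<close> unless its linear term vanishes;
  the point \<open>t = - b / (c + 1)\<close> shows this also for \<open>c = 0\<close>. This turns minimality into a linear
  identity.
\<close>
lemma real_quadratic_nonneg:
  fixes b c :: real
  assumes "\<And>t. 0 \<le> 2 * t * b + t\<^sup>2 * c" and "c \<ge> 0"
  shows "b = 0"
proof -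
  have "0 \<le> 2 * (- b / (c + 1)) * b + (- b / (c + 1))\<^sup>2 * c"
    using assms(1)[of "- b / (c + 1)"] .
  also have "\<dots> = - (b\<^sup>2 * (c + 2) / (c + 1)\<^sup>2)"
    using assms(2) by (simp add: power2_eq_square divide_simps) (simp add: algebra_simps)
  finally have "b\<^sup>2 * (c + 2) / (c + 1)\<^sup>2 \<le> 0" by simp
  then have "b\<^sup>2 * (c + 2) \<le> 0"
    using assms(2) by (simp add: divide_le_0_iff)
  then show ?thesis
    using assms(2) by (simp add: mult_le_0_iff)
qed

text \<open>
  Riesz' theorem for a functional given on the range of \<open>B\<close> through its pullback \<open>g\<close>: it covers
  functionals on the whole space, orthogonal projections onto the closure of a subspace, and the
  factorization of operators. A sequence minimizing \<open>\<parallel>B x\<parallel>\<^sup>2 - 2 g x\<close> is mapped by \<open>B\<close> to a Cauchy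
  sequence, by the parallelogram law, and the first variation at its limit \<open>v\<close> gives
  \<open>g x = \<langle>v, B x\<rangle>\<close>. No minimizer \<open>x\<close> need exist.
\<close>
lemma riesz_subspace:
  fixes B :: "'a::real_vector \<Rightarrow> 'h::{real_inner, complete_space}" and g :: "'a \<Rightarrow> real"
  assumes M: "subspace M" and B: "linear B" and g: "linear g"
    and bound: "\<And>x. x \<in> M \<Longrightarrow> \<bar>g x\<bar> \<le> C * norm (B x)" and C: "C \<ge> 0"
  obtains v where "v \<in> closure (B ` M)" "\<And>x. x \<in> M \<Longrightarrow> g x = inner v (B x)" "norm v \<le> C"
proof -
  define J where "J x = (norm (B x))\<^sup>2 - 2 * g x" for x
  have J_lower: "- C\<^sup>2 \<le> J x" if "x \<in> M" for x
  proof -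
    have "0 \<le> (norm (B x) - C)\<^sup>2" by simp
    also have "\<dots> = (norm (B x))\<^sup>2 - 2 * (C * norm (B x)) + C\<^sup>2" by (simp add: power2_diff)
    also have "\<dots> \<le> J x + C\<^sup>2" using bound[OF that] by (simp add: J_def)
    finally show ?thesis by simp
  qed
  define d where "d = Inf (J ` M)"
  have bdd: "bdd_below (J ` M)" using J_lower by (rule bdd_belowI2)
  have ne: "J ` M \<noteq> {}" using subspace_0[OF M] by blast
  have d_le: "d \<le> J x" if "x \<in> M" for x
    unfolding d_def using bdd that by (simp add: cInf_lower)
  have "\<exists>x\<in>M. J x < d + 1 / real (Suc n)" for n
    using cInf_lessD[OF ne, of "d + 1 / real (Suc n)"] by (auto simp: d_def)
  then obtain X where X: "\<And>n. X n \<in> M" "\<And>n. J (X n) < d + 1 / real (Suc n)"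
    by metis
  have dist_le: "(norm (B (X m) - B (X n)))\<^sup>2 \<le> 2 / real (Suc m) + 2 / real (Suc n)" for m n
  proof -
    let ?h = "(1/2) *\<^sub>R (X m + X n)"
    have "?h \<in> M" using X(1) M by (intro subspace_scale subspace_add)
    from d_le[OF this] have "4 * d \<le> 4 * (norm ((1/2) *\<^sub>R (B (X m) + B (X n))))\<^sup>2 - 4 * (g (X m) + g (X n))"
      by (simp add: J_def linear_add[OF B] linear_scale[OF B] linear_add[OF g] linear_scale[OF g]
          add_divide_distrib)
    also have "4 * (norm ((1/2) *\<^sub>R (B (X m) + B (X n))))\<^sup>2 = (norm (B (X m) + B (X n)))\<^sup>2"
      by (simp add: power_divide)
    also have "\<dots> = 2 * (norm (B (X m)))\<^sup>2 + 2 * (norm (B (X n)))\<^sup>2 - (norm (B (X m) - B (X n)))\<^sup>2"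
      by (simp add: power2_norm_eq_inner algebra_simps)
    finally have "(norm (B (X m) - B (X n)))\<^sup>2 \<le> 2 * J (X m) + 2 * J (X n) - 4 * d"
      by (simp add: J_def algebra_simps)
    then show ?thesis using X(2)[of m] X(2)[of n] by simp
  qed
  have "Cauchy (\<lambda>n. B (X n))"
  proof (rule CauchyI)
    fix e :: real assume e: "0 < e"
    obtain N where N: "4 / e\<^sup>2 < real N" using reals_Archimedean2 by blast
    have "norm (B (X m) - B (X n)) < e" if "m \<ge> N" "n \<ge> N" for m n
    proof -
      have pos: "0 < real N" using N e by (smt (verit) divide_pos_pos zero_less_power)
      have "2 / real (Suc m) + 2 / real (Suc n) \<le> 2 / real N + 2 / real N"
        using that pos by (intro add_mono divide_left_mono) auto
      also have "\<dots> < e\<^sup>2" using N e pos by (simp add: field_simps)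
      finally have "(norm (B (X m) - B (X n)))\<^sup>2 < e\<^sup>2" using dist_le[of m n] by linarith
      then show ?thesis using e by (rule power2_less_imp_less[OF _ less_imp_le])
    qed
    then show "\<exists>M. \<forall>m\<ge>M. \<forall>n\<ge>M. norm (B (X m) - B (X n)) < e" by blast
  qed
  then obtain v where v: "(\<lambda>n. B (X n)) \<longlonglongrightarrow> v"
    using Cauchy_convergent_iff convergent_def by blast
  have vcl: "v \<in> closure (B ` M)"
    unfolding closure_sequential by (rule exI[of _ "\<lambda>n. B (X n)"]) (use v X(1) in auto)
  have eq: "g h = inner v (B h)" if h: "h \<in> M" for h
  proof -
    have "0 \<le> 2 * t * (inner v (B h) - g h) + t\<^sup>2 * (norm (B h))\<^sup>2" for t
    proof -
      have "- 1 / real (Suc n) \<le> 2 * t * (inner (B (X n)) (B h) - g h) + t\<^sup>2 * (norm (B h))\<^sup>2" for n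
      proof -
        have "X n + t *\<^sub>R h \<in> M" using X(1) h M by (intro subspace_scale subspace_add)
        from d_le[OF this] have "d \<le> J (X n) + 2 * t * (inner (B (X n)) (B h) - g h) + t\<^sup>2 * (norm (B h))\<^sup>2"
          unfolding J_def power2_norm_eq_inner linear_add[OF B] linear_scale[OF B] linear_add[OF g] linear_scale[OF g]
          by (simp add: algebra_simps inner_commute power2_eq_square)
        then show ?thesis using X(2)[of n] by simp
      qed
      moreover have "(\<lambda>n. - 1 / real (Suc n)) \<longlonglongrightarrow> 0"
        using tendsto_minus[OF LIMSEQ_inverse_real_of_nat] by (simp add: inverse_eq_divide)
      moreover have "(\<lambda>n. 2 * t * (inner (B (X n)) (B h) - g h) + t\<^sup>2 * (norm (B h))\<^sup>2)
          \<longlonglongrightarrow> 2 * t * (inner v (B h) - g h) + t\<^sup>2 * (norm (B h))\<^sup>2"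
        by (intro tendsto_intros v)
      ultimately show ?thesis by (intro LIMSEQ_le) auto
    qed
    then have "inner v (B h) - g h = 0" by (rule real_quadratic_nonneg) simp
    then show ?thesis by simp
  qed
  have "inner v u \<le> C * norm u" if "u \<in> closure (B ` M)" for u
  proof -
    have "closed {u. inner v u \<le> C * norm u}"
      by (intro closed_Collect_le continuous_intros)
    moreover have "B ` M \<subseteq> {u. inner v u \<le> C * norm u}"
      using bound by (auto simp flip: eq) (smt (verit))
    ultimately show ?thesis using closure_minimal that by blast
  qed
  from this[OF vcl] have "norm v * norm v \<le> C * norm v"
    by (simp add: power2_norm_eq_inner flip: power2_eq_square)
  then have "norm v \<le> C" using C by (cases "norm v = 0") auto
  then show ?thesis using that vcl eq by blast
qed

lemma orthogonal_closureD:
  fixes w :: "'h::real_inner"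
  assumes "\<And>x. x \<in> S \<Longrightarrow> inner w x = 0" and "u \<in> closure S"
  shows "inner w u = 0"
proof -
  have "closed {u. inner w u = 0}" by (intro closed_Collect_eq continuous_intros)
  then show ?thesis using closure_minimal[of S "{u. inner w u = 0}"] assms by blast
qed

section \<open>Bounded operators and their adjoints\<close>

lemma bounded_opsD: "A \<in> bounded_ops \<Longrightarrow> blinfun_apply A (c *\<^sub>C x) = c *\<^sub>C blinfun_apply A x"
  by (simp add: bounded_ops_def)

lemma scaleC_blinfun_apply [simp]:
  "blinfun_apply (c *\<^sub>C A) x = c *\<^sub>C blinfun_apply A x"
  by transfer simp

lemma bounded_ops_closed [simp, intro]:
  shows "A \<in> bounded_ops \<Longrightarrow> B \<in> bounded_ops \<Longrightarrow> A o\<^sub>L B \<in> bounded_ops"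
    and "A \<in> bounded_ops \<Longrightarrow> B \<in> bounded_ops \<Longrightarrow> A + B \<in> bounded_ops"
    and "A \<in> bounded_ops \<Longrightarrow> B \<in> bounded_ops \<Longrightarrow> A - B \<in> bounded_ops"
    and "A \<in> bounded_ops \<Longrightarrow> c *\<^sub>C A \<in> bounded_ops"
    and "A \<in> bounded_ops \<Longrightarrow> r *\<^sub>R A \<in> bounded_ops"
    and "id_blinfun \<in> bounded_ops" and "0 \<in> bounded_ops"
  by (auto simp: bounded_ops_def blinfun.add_left blinfun.diff_left blinfun.scaleR_left
      scaleC_add_right scaleC_diff_right scaleC_scaleC scaleC_scaleR mult.commute)

lemma op_eqI:
  fixes A B :: "'h::chilbert_space operator"
  assumes "\<And>x y. cinner x (blinfun_apply A y) = cinner x (blinfun_apply B y)"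
  shows "A = B"
  by (rule blinfun_eqI, rule cinner_ext, rule assms)

text \<open>Polarization: a sesquilinear form vanishes as soon as its quadratic form does.\<close>
lemma op_eqI_diag:
  fixes A B :: "'h::chilbert_space operator"
  assumes A: "A \<in> bounded_ops" and B: "B \<in> bounded_ops"
    and eq: "\<And>x. cinner x (blinfun_apply A x) = cinner x (blinfun_apply B x)"
  shows "A = B"
proof (rule op_eqI)
  fix x y
  let ?D = "\<lambda>x y. cinner x (blinfun_apply A y) - cinner x (blinfun_apply B y)"
  have D0: "?D x x = 0" for x using eq by simp
  have 1: "?D x y + ?D y x = 0"
    using D0[of "x + y"] D0[of x] D0[of y]
    by (simp add: cinner_simps blinfun.add_right algebra_simps)
  have "\<i> * (?D x y - ?D y x) = 0"
    using D0[of "x + \<i> *\<^sub>C y"] D0[of x] D0[of y]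
    by (simp add: cinner_simps blinfun.add_right bounded_opsD[OF A] bounded_opsD[OF B] algebra_simps)
  then have "?D x y = ?D y x" by simp
  with 1 have "?D x y = 0"
    by (metis add_eq_0_iff eq_neg_iff_add_eq_0 mult_2 mult_eq_0_iff zero_neq_numeral)
  then show "cinner x (blinfun_apply A y) = cinner x (blinfun_apply B y)" by simp
qed

text \<open>
  For fixed \<open>x\<close> Riesz' theorem represents the real part of \<open>b y x\<close> as a function of \<open>y\<close>; the
  representing vector is unique, so it depends linearly on \<open>x\<close>.
\<close>
lemma sesquilinear_form_representation:
  fixes b :: "'h::chilbert_space \<Rightarrow> 'h \<Rightarrow> complex"
  assumes add_right: "\<And>y x x'. b y (x + x') = b y x + b y x'"
    and scale_right: "\<And>c y x. b y (c *\<^sub>C x) = c * b y x"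
    and add_left: "\<And>y y' x. b (y + y') x = b y x + b y' x"
    and scale_left: "\<And>c y x. b (c *\<^sub>C y) x = cnj c * b y x"
    and bound: "\<And>y x. norm (b y x) \<le> C * (norm y * norm x)" and C: "C \<ge> 0"
  obtains R where "R \<in> bounded_ops" "\<And>y x. cinner y (blinfun_apply R x) = b y x"
proof -
  have "\<exists>v. (\<forall>y. Re (b y x) = inner v y) \<and> norm v \<le> C * norm x" for x
  proof -
    have lin: "linear (\<lambda>y. Re (b y x))"
      by (rule linearI) (simp_all add: add_left scaleR_scaleC scale_left)
    have bd: "\<bar>Re (b y x)\<bar> \<le> (C * norm x) * norm y" for y
      using bound[of y x] abs_Re_le_cmod[of "b y x"] by (simp add: ac_simps)
    obtain v where "\<And>y. y \<in> UNIV \<Longrightarrow> Re (b y x) = inner v y" "norm v \<le> C * norm x"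
      by (rule riesz_subspace[OF subspace_UNIV linear_ident lin bd]) (use C in auto)
    then show ?thesis by blast
  qed
  then obtain r where r: "\<And>x y. Re (b y x) = inner (r x) y" "\<And>x. norm (r x) \<le> C * norm x"
    by metis
  have rc: "cinner y (r x) = b y x" for x y
    by (rule cinner_eqI) (simp_all add: r(1) scale_left inner_commute)
  have radd: "r (x + x') = r x + r x'" for x x'
    by (rule cinner_ext) (simp add: rc add_right cinner_add_right)
  have rscale: "r (c *\<^sub>C x) = c *\<^sub>C r x" for c x
    by (rule cinner_ext) (simp add: rc scale_right cinner_scaleC_right)
  have "bounded_linear r"
    by (rule bounded_linear_intro[where K = C])
      (use r(2) in \<open>simp_all add: radd rscale scaleR_scaleC mult.commute\<close>)
  then have ap: "blinfun_apply (Blinfun r) = r" by (rule bounded_linear_Blinfun_apply)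
  show ?thesis
    by (rule that[of "Blinfun r"]) (simp_all add: bounded_ops_def ap rscale rc)
qed

lemma adjoint_op:
  fixes A :: "'h::chilbert_space operator"
  assumes A: "A \<in> bounded_ops"
  shows adjoint_op_bounded: "adjoint_op A \<in> bounded_ops"
    and cinner_adjoint_left: "cinner (blinfun_apply (adjoint_op A) x) y = cinner x (blinfun_apply A y)"
proof -
  obtain R where R: "R \<in> bounded_ops" "\<And>y x. cinner y (blinfun_apply R x) = cinner (blinfun_apply A y) x"
  proof (rule sesquilinear_form_representation[where b = "\<lambda>y x. cinner (blinfun_apply A y) x" and C = "norm A"])
    show "cmod (cinner (blinfun_apply A y) x) \<le> norm A * (norm y * norm x)" for x y
      using Cauchy_Schwarz_cinner[of "blinfun_apply A y" x] norm_blinfun[of A y]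
      by (smt (verit) mult.assoc mult_right_mono norm_ge_zero)
  qed (simp_all add: cinner_simps blinfun.add_right bounded_opsD[OF A])
  have R': "cinner (blinfun_apply R x) y = cinner x (blinfun_apply A y)" for x y
    by (metis R(2) cinner_commute)
  have "adjoint_op A \<in> bounded_ops \<and>
      (\<forall>x y. cinner (blinfun_apply (adjoint_op A) x) y = cinner x (blinfun_apply A y))"
    unfolding adjoint_op_def
  proof (rule theI[of _ R])
    fix B assume "B \<in> bounded_ops \<and> (\<forall>x y. cinner (blinfun_apply B x) y = cinner x (blinfun_apply A y))"
    then show "B = R" by (metis R(2) cinner_commute op_eqI)
  qed (use R R' in blast)
  then show "adjoint_op A \<in> bounded_ops"
    "cinner (blinfun_apply (adjoint_op A) x) y = cinner x (blinfun_apply A y)" by blast+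
qed

lemma cinner_adjoint_right:
  "A \<in> bounded_ops \<Longrightarrow> cinner x (blinfun_apply (adjoint_op A) y) = cinner (blinfun_apply A x) y"
  by (metis cinner_adjoint_left cinner_commute)

lemma adjoint_op_eqI:
  assumes "A \<in> bounded_ops" "B \<in> bounded_ops"
    and "\<And>x y. cinner (blinfun_apply B x) y = cinner x (blinfun_apply A y)"
  shows "adjoint_op A = B"
  by (rule op_eqI) (metis assms cinner_adjoint_right cinner_commute)

lemma adjoint_adjoint [simp]: "A \<in> bounded_ops \<Longrightarrow> adjoint_op (adjoint_op A) = A"
  by (intro adjoint_op_eqI) (simp_all add: adjoint_op_bounded cinner_adjoint_right)

lemma adjoint_compose:
  "A \<in> bounded_ops \<Longrightarrow> B \<in> bounded_ops \<Longrightarrow> adjoint_op (A o\<^sub>L B) = adjoint_op B o\<^sub>L adjoint_op A"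
  by (intro adjoint_op_eqI) (simp_all add: adjoint_op_bounded cinner_adjoint_left)

lemma adjoint_id: "adjoint_op id_blinfun = (id_blinfun :: 'h::chilbert_space operator)"
  by (intro adjoint_op_eqI) auto

declare adjoint_op_bounded [simp, intro]

text \<open>
  Douglas' lemma. The inequality makes \<open>B x \<mapsto> \<langle>z, A x\<rangle>\<close> well defined and bounded, and the vector
  \<open>V z\<close> in the closed range of \<open>B\<close> that represents it depends linearly on \<open>z\<close>; the factor \<open>U\<close> is the adjoint of \<open>V\<close>. Applied in both
  directions it gives the polar decomposition without a construction of partial isometries.
\<close>
lemma douglas_factorization:
  fixes A B :: "'h::chilbert_space operator"
  assumes A: "A \<in> bounded_ops" and B: "B \<in> bounded_ops"
    and le: "\<And>x. norm (blinfun_apply A x) \<le> norm (blinfun_apply B x)"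
  obtains U where "U \<in> bounded_ops" "A = U o\<^sub>L B"
proof -
  let ?R = "range (blinfun_apply B)"
  have "\<exists>v. v \<in> closure ?R \<and> (\<forall>x. inner z (blinfun_apply A x) = inner v (blinfun_apply B x)) \<and> norm v \<le> norm z" for z
  proof -
    have lin: "linear (\<lambda>x. inner z (blinfun_apply A x))"
      by (rule linearI) (simp_all add: blinfun.add_right blinfun.scaleR_right inner_add_right)
    have bd: "\<bar>inner z (blinfun_apply A x)\<bar> \<le> norm z * norm (blinfun_apply B x)" for x
      using Cauchy_Schwarz_ineq2[of z "blinfun_apply A x"] le[of x]
      by (smt (verit) mult_left_mono norm_ge_zero)
    have linB: "linear (blinfun_apply B)"
      by (simp add: blinfun.bounded_linear_right bounded_linear.linear)
    obtain v where "v \<in> closure ?R" "\<And>x. x \<in> UNIV \<Longrightarrow> inner z (blinfun_apply A x) = inner v (blinfun_apply B x)"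
      "norm v \<le> norm z"
      by (rule riesz_subspace[OF subspace_UNIV linB lin bd]) auto
    then show ?thesis by blast
  qed
  then obtain V where V: "\<And>z. V z \<in> closure ?R" "\<And>z x. inner z (blinfun_apply A x) = inner (V z) (blinfun_apply B x)"
    "\<And>z. norm (V z) \<le> norm z" by metis
  have Vc: "cinner (V z) (blinfun_apply B x) = cinner z (blinfun_apply A x)" for z x
  proof -
    have "Re (cinner (V z) (blinfun_apply B x)) = Re (cinner z (blinfun_apply A x))" for x
      using V(2)[of z x] by (simp add: inner_eq_Re_cinner)
    from this[of x] this[of "\<i> *\<^sub>C x"] show ?thesis
      by (simp add: complex_eq_iff bounded_opsD[OF A] bounded_opsD[OF B] cinner_scaleC_right)
  qed
  \<comment> \<open>the values of \<open>V\<close> lie in the closed range of \<open>B\<close>, so they are determined by their inner products with it\<close>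
  have orth: "cinner w u = 0"
    if w: "\<And>x. cinner w (blinfun_apply B x) = 0" and u: "u \<in> closure ?R" for w u
  proof -
    have "inner (c *\<^sub>C w) u = 0" for c
      by (rule orthogonal_closureD[OF _ u]) (auto simp: inner_eq_Re_cinner cinner_scaleC_left w)
    from this[of 1] this[of \<i>] show ?thesis
      by (simp add: complex_eq_iff inner_eq_Re_cinner Im_cinner)
  qed
  have Vadd: "V (x + y) = V x + V y" for x y
  proof -
    let ?w = "V (x + y) - (V x + V y)"
    have "cinner ?w (blinfun_apply B u) = 0" for u by (simp add: cinner_simps Vc)
    from orth[OF this V(1)] have "cinner ?w ?w = 0" by (simp add: cinner_diff_right cinner_add_right)
    then show ?thesis by (simp add: cinner_self)
  qed
  have Vscale: "V (c *\<^sub>C x) = c *\<^sub>C V x" for c x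
  proof -
    let ?w = "V (c *\<^sub>C x) - c *\<^sub>C V x"
    have "cinner ?w (blinfun_apply B u) = 0" for u by (simp add: cinner_simps Vc)
    from orth[OF this V(1)] have "cinner ?w ?w = 0" by (simp add: cinner_diff_right cinner_scaleC_right)
    then show ?thesis by (simp add: cinner_self)
  qed
  have "bounded_linear V"
    by (rule bounded_linear_intro[where K = 1]) (use V(3) in \<open>simp_all add: Vadd Vscale scaleR_scaleC\<close>)
  then have ap: "blinfun_apply (Blinfun V) = V" by (rule bounded_linear_Blinfun_apply)
  have Vb: "Blinfun V \<in> bounded_ops" by (simp add: bounded_ops_def ap Vscale)
  have "A = adjoint_op (Blinfun V) o\<^sub>L B"
    by (rule op_eqI) (simp add: cinner_adjoint_right[OF Vb] ap Vc)
  then show ?thesis using that adjoint_op_bounded[OF Vb] by blast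
qed

section \<open>Positive operators and their square roots\<close>

lemma positive_opD:
  assumes "positive_op P"
  shows positive_op_bounded: "P \<in> bounded_ops"
    and positive_op_Re: "0 \<le> Re (cinner x (blinfun_apply P x))"
    and positive_op_Im: "Im (cinner x (blinfun_apply P x)) = 0"
  using assms by (auto simp: positive_op_def complex_nonneg_Reals_iff)

text \<open>
  Over the complex numbers a real quadratic form has a Hermitian sesquilinear form: compare the
  values at \<open>x + y\<close> and \<open>x + \<i> y\<close>.
\<close>
lemma positive_op_symmetric:
  assumes P: "positive_op P"
  shows "cinner x (blinfun_apply P y) = cinner (blinfun_apply P x) y"
proof -
  note b = positive_op_bounded[OF P]
  let ?p = "\<lambda>x y. cinner x (blinfun_apply P y)"
  have 1: "Im (?p x y + ?p y x) = 0"
    using positive_op_Im[OF P, of "x + y"] positive_op_Im[OF P, of x] positive_op_Im[OF P, of y]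
    by (simp add: cinner_simps blinfun.add_right)
  have 2: "Im (\<i> * ?p x y - \<i> * ?p y x) = 0"
    using positive_op_Im[OF P, of "x + \<i> *\<^sub>C y"] positive_op_Im[OF P, of x] positive_op_Im[OF P, of y]
    by (simp add: cinner_simps blinfun.add_right bounded_opsD[OF b])
  have "?p x y = cnj (?p y x)" using 1 2 by (simp add: complex_eq_iff)
  then show ?thesis by (metis cinner_commute)
qed

lemma positive_op_adjoint: "positive_op P \<Longrightarrow> adjoint_op P = P"
  by (intro adjoint_op_eqI) (simp_all add: positive_op_bounded positive_op_symmetric)

lemma positive_opI:
  assumes P: "P \<in> bounded_ops" and sym: "\<And>x y. cinner x (blinfun_apply P y) = cinner (blinfun_apply P x) y"
    and pos: "\<And>x. 0 \<le> Re (cinner x (blinfun_apply P x))"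
  shows "positive_op P"
proof -
  have "Im (cinner x (blinfun_apply P x)) = 0" for x
    using arg_cong[OF cinner_commute[of x "blinfun_apply P x"], of Im] sym[of x x] by simp
  then show ?thesis using P pos by (simp add: positive_op_def complex_nonneg_Reals_iff)
qed

lemma positive_op_square:
  assumes "A \<in> bounded_ops" shows "positive_op (adjoint_op A o\<^sub>L A)"
  using assms by (intro positive_opI) (simp_all add: cinner_adjoint_right cinner_adjoint_left cinner_self_Re)

text \<open>
  Positivity of the form at \<open>x - P x / \<parallel>P\<parallel>\<close>. In particular \<open>\<langle>x, P x\<rangle> = 0\<close> implies \<open>P x = 0\<close>, and
  \<open>\<parallel>1 - P\<parallel> \<le> 1\<close> if \<open>\<parallel>P\<parallel> \<le> 1\<close>.
\<close>
lemma positive_op_norm_le: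
  assumes P: "positive_op P"
  shows "(norm (blinfun_apply P x))\<^sup>2 \<le> norm P * Re (cinner x (blinfun_apply P x))"
proof (cases "norm P = 0")
  case True then show ?thesis by simp
next
  case False
  define k where "k = norm P"
  have k: "k > 0" using False by (simp add: k_def)
  let ?y = "blinfun_apply P x" and ?b = "(norm (blinfun_apply P x))\<^sup>2"
  have "Re (cinner ?y (blinfun_apply P ?y)) \<le> norm ?y * (k * norm ?y)"
    using order_trans[OF norm_cauchy_schwarz mult_left_mono[OF norm_blinfun[of P ?y] norm_ge_zero]]
    by (simp add: inner_eq_Re_cinner k_def)
  then have q: "Re (cinner ?y (blinfun_apply P ?y)) \<le> k * ?b" by (simp add: power2_eq_square ac_simps)
  have s: "Re (cinner x (blinfun_apply P ?y)) = ?b"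
    using positive_op_symmetric[OF P, of x ?y] by (simp add: cinner_self_Re)
  let ?z = "x - (1 / k) *\<^sub>R ?y"
  have "0 \<le> Re (cinner ?z (blinfun_apply P ?z))" by (rule positive_op_Re[OF P])
  also have "\<dots> = Re (cinner x ?y) - 2 * (?b / k) + Re (cinner ?y (blinfun_apply P ?y)) / k\<^sup>2"
    by (simp add: cinner_diff_left cinner_diff_right blinfun.diff_right blinfun.scaleR_right
        cinner_scaleR_left cinner_scaleR_right s cinner_self_Re power2_eq_square)
      (use k in \<open>simp add: field_simps\<close>)
  also have "\<dots> \<le> Re (cinner x ?y) - 2 * (?b / k) + (k * ?b) / k\<^sup>2"
    using q k by (intro add_left_mono divide_right_mono) auto
  also have "\<dots> = Re (cinner x ?y) - ?b / k" using k by (simp add: power2_eq_square field_simps)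
  finally show ?thesis using k by (simp add: k_def field_simps)
qed

text \<open>
  A limit \<open>Y\<close> of this iteration satisfies \<open>2 Y = X + Y\<^sup>2\<close>, that is \<open>(1 - Y)\<^sup>2 = 1 - X\<close>. All iterates
  are polynomials in \<open>X\<close>, so they commute with each other and with whatever commutes with \<open>X\<close>.
\<close>
primrec sqrt_iter :: "'h::chilbert_space operator \<Rightarrow> nat \<Rightarrow> 'h operator" where
  "sqrt_iter X 0 = 0"
| "sqrt_iter X (Suc n) = (1/2) *\<^sub>R (X + (sqrt_iter X n o\<^sub>L sqrt_iter X n))"

lemmas compose_distribs =
  bounded_bilinear.add_left[OF bounded_bilinear_blinfun_compose]
  bounded_bilinear.add_right[OF bounded_bilinear_blinfun_compose]
  bounded_bilinear.diff_left[OF bounded_bilinear_blinfun_compose]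
  bounded_bilinear.diff_right[OF bounded_bilinear_blinfun_compose]
  bounded_bilinear.scaleR_left[OF bounded_bilinear_blinfun_compose]
  bounded_bilinear.scaleR_right[OF bounded_bilinear_blinfun_compose]

lemma compose_assoc: "(A o\<^sub>L B) o\<^sub>L C = A o\<^sub>L (B o\<^sub>L C)"
  by (rule blinfun_eqI) simp

lemma sqrt_iter_commute:
  "Z o\<^sub>L X = X o\<^sub>L Z \<Longrightarrow> Z o\<^sub>L sqrt_iter X n = sqrt_iter X n o\<^sub>L Z"
proof (induction n)
  case 0 show ?case by (simp add: blinfun_eqI)
next
  case (Suc n)
  have "Z o\<^sub>L (sqrt_iter X n o\<^sub>L sqrt_iter X n) = (sqrt_iter X n o\<^sub>L sqrt_iter X n) o\<^sub>L Z"
    by (simp only: Suc.IH[OF Suc.prems] compose_assoc flip: compose_assoc[of Z])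
  then show ?case using Suc.prems by (simp add: compose_distribs)
qed

lemma sqrt_iter_bounded: "X \<in> bounded_ops \<Longrightarrow> sqrt_iter X n \<in> bounded_ops"
  by (induction n) auto

lemma sqrt_iter_symmetric:
  assumes "\<And>x y. cinner x (blinfun_apply X y) = cinner (blinfun_apply X x) y"
  shows "cinner x (blinfun_apply (sqrt_iter X n) y) = cinner (blinfun_apply (sqrt_iter X n) x) y"
  by (induction n arbitrary: x y)
    (simp_all add: cinner_add_left cinner_add_right cinner_scaleR_left cinner_scaleR_right assms
      blinfun.add_left blinfun.scaleR_left)

text \<open>
  The scalar iteration for \<open>X = 1\<close>. The iterates are polynomials in \<open>X\<close> with nonnegative
  coefficients, and so are their successive differences; hence for \<open>\<parallel>X\<parallel> \<le> 1\<close> the scalar iteration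
  majorizes both, and its convergence gives convergence in operator norm.
\<close>
primrec sqrt_bound :: "nat \<Rightarrow> real" where
  "sqrt_bound 0 = 0"
| "sqrt_bound (Suc n) = (1 + (sqrt_bound n)\<^sup>2) / 2"

lemma sqrt_bound_range: "0 \<le> sqrt_bound n \<and> sqrt_bound n \<le> 1"
  by (induction n) (auto simp: power_le_one add_nonneg_nonneg)

lemma sqrt_bound_mono: "sqrt_bound n \<le> sqrt_bound (Suc n)"
proof -
  have "0 \<le> (1 - sqrt_bound n)\<^sup>2" by simp
  then show ?thesis by (simp add: power2_diff)
qed

lemma convergent_sqrt_bound: "convergent sqrt_bound"
proof -
  have "incseq sqrt_bound" using sqrt_bound_mono by (rule incseq_SucI)
  moreover have "\<And>n. sqrt_bound n \<le> 1" using sqrt_bound_range by blast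
  ultimately show ?thesis by (auto elim!: incseq_convergent intro: convergentI)
qed

lemma norm_sqrt_iter_le:
  assumes X: "norm X \<le> 1"
  shows "norm (sqrt_iter X n) \<le> sqrt_bound n"
proof (induction n)
  case (Suc n)
  have "norm (sqrt_iter X n o\<^sub>L sqrt_iter X n) \<le> norm (sqrt_iter X n) * norm (sqrt_iter X n)"
    by (rule norm_blinfun_compose)
  also have "\<dots> \<le> (sqrt_bound n)\<^sup>2"
    using Suc by (simp add: power2_eq_square mult_mono')
  finally have "norm (X + (sqrt_iter X n o\<^sub>L sqrt_iter X n)) \<le> 1 + (sqrt_bound n)\<^sup>2"
    using X norm_triangle_ineq by (smt (verit))
  then show ?case by simp
qed simp

lemma norm_sqrt_iter_step:
  assumes X: "norm X \<le> 1"
  shows "norm (sqrt_iter X (Suc n) - sqrt_iter X n) \<le> sqrt_bound (Suc n) - sqrt_bound n"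
proof (induction n)
  case 0 then show ?case using X by simp
next
  case (Suc n)
  let ?A = "sqrt_iter X (Suc n)" and ?B = "sqrt_iter X n"
  have "X o\<^sub>L ?B = ?B o\<^sub>L X" by (rule sqrt_iter_commute) simp
  then have "?A o\<^sub>L ?B = ?B o\<^sub>L ?A" by (rule sqrt_iter_commute[OF sym, symmetric])
  then have "(1/2) *\<^sub>R (X + (?A o\<^sub>L ?A)) - (1/2) *\<^sub>R (X + (?B o\<^sub>L ?B)) = (1/2) *\<^sub>R ((?A + ?B) o\<^sub>L (?A - ?B))"
    unfolding scaleR_diff_right[symmetric] compose_distribs by simp
  then have "sqrt_iter X (Suc (Suc n)) - ?A = (1/2) *\<^sub>R ((?A + ?B) o\<^sub>L (?A - ?B))"
    by (simp only: sqrt_iter.simps(2))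
  then have "norm (sqrt_iter X (Suc (Suc n)) - ?A) = norm ((?A + ?B) o\<^sub>L (?A - ?B)) / 2"
    by simp
  also have "\<dots> \<le> norm (?A + ?B) * norm (?A - ?B) / 2"
    by (simp add: norm_blinfun_compose)
  also have "\<dots> \<le> (sqrt_bound (Suc n) + sqrt_bound n) * (sqrt_bound (Suc n) - sqrt_bound n) / 2"
    using norm_triangle_ineq[of ?A ?B] norm_sqrt_iter_le[OF X, of "Suc n"] norm_sqrt_iter_le[OF X, of n] Suc.IH
      sqrt_bound_range
    by (intro divide_right_mono mult_mono) (auto simp del: sqrt_iter.simps sqrt_bound.simps intro: add_nonneg_nonneg)
  also have "\<dots> = sqrt_bound (Suc (Suc n)) - sqrt_bound (Suc n)"
  proof -
    have "(a + b) * (a - b) / 2 = (1 + a\<^sup>2) / 2 - (1 + b\<^sup>2) / 2" for a b :: real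
      by (simp add: power2_eq_square field_simps)
    then show ?thesis by (simp only: sqrt_bound.simps(2))
  qed
  finally show ?case .
qed

lemma sqrt_iter_Cauchy:
  assumes X: "norm X \<le> 1"
  shows "Cauchy (sqrt_iter X)"
proof (rule CauchyI')
  have le: "norm (sqrt_iter X n - sqrt_iter X m) \<le> sqrt_bound n - sqrt_bound m" if "m \<le> n" for m n
    using that
  proof (induction n rule: dec_induct)
    case (step n)
    have "norm (sqrt_iter X (Suc n) - sqrt_iter X m)
        \<le> norm (sqrt_iter X (Suc n) - sqrt_iter X n) + norm (sqrt_iter X n - sqrt_iter X m)"
      by norm
    then show ?case using step.IH norm_sqrt_iter_step[OF X, of n] by linarith
  qed simp
  fix e :: real assume "0 < e"
  moreover have "Cauchy sqrt_bound" using convergent_sqrt_bound by (rule convergent_Cauchy)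
  ultimately obtain M where M: "\<And>m n. m \<ge> M \<Longrightarrow> n \<ge> M \<Longrightarrow> dist (sqrt_bound m) (sqrt_bound n) < e"
    unfolding Cauchy_def by metis
  have "dist (sqrt_iter X m) (sqrt_iter X n) < e" if "m \<ge> M" "n > m" for m n
    using le[of m n] M[of m n] that by (auto simp: dist_norm norm_minus_commute[of "sqrt_iter X m"])
  then show "\<exists>M. \<forall>m\<ge>M. \<forall>n>m. dist (sqrt_iter X m) (sqrt_iter X n) < e" by blast
qed

text \<open>
  The commutation property of the constructed root is what makes every other positive root agree
  with it (\<open>positive_sqrt_unique\<close>).
\<close>
lemma positive_sqrt_contraction:
  fixes T :: "'h::chilbert_space operator"
  assumes T: "positive_op T" and le: "norm T \<le> 1"
  obtains S where "positive_op S" "S o\<^sub>L S = T" "\<And>Z. Z o\<^sub>L T = T o\<^sub>L Z \<Longrightarrow> Z o\<^sub>L S = S o\<^sub>L Z"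
proof -
  define X where "X = id_blinfun - T"
  note Tb = positive_op_bounded[OF T]
  have Xb: "X \<in> bounded_ops" using Tb by (simp add: X_def)
  have Xs: "cinner x (blinfun_apply X y) = cinner (blinfun_apply X x) y" for x y
    by (simp add: X_def blinfun.diff_left cinner_simps positive_op_symmetric[OF T])
  have X1: "norm X \<le> 1"
  proof (rule norm_blinfun_bound)
    fix x
    have "(norm (blinfun_apply T x))\<^sup>2 \<le> norm T * Re (cinner x (blinfun_apply T x))"
      by (rule positive_op_norm_le[OF T])
    also have "\<dots> \<le> Re (cinner x (blinfun_apply T x))"
      using le positive_op_Re[OF T, of x] by (simp add: mult_left_le_one_le)
    finally have 1: "(norm (blinfun_apply T x))\<^sup>2 \<le> inner x (blinfun_apply T x)"
      by (simp add: inner_eq_Re_cinner)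
    have "(norm (blinfun_apply X x))\<^sup>2 = (norm x)\<^sup>2 - 2 * inner x (blinfun_apply T x) + (norm (blinfun_apply T x))\<^sup>2"
      by (simp add: X_def blinfun.diff_left power2_norm_eq_inner inner_diff_left inner_diff_right inner_commute)
    also have "\<dots> \<le> (norm x)\<^sup>2"
      using 1 positive_op_Re[OF T, of x] by (simp add: inner_eq_Re_cinner)
    finally have "norm (blinfun_apply X x) \<le> norm x"
      by (rule power2_le_imp_le) simp
    then show "norm (blinfun_apply X x) \<le> 1 * norm x" by simp
  qed simp
  obtain Y where Y: "sqrt_iter X \<longlonglongrightarrow> Y"
    using sqrt_iter_Cauchy[OF X1] Cauchy_convergent_iff convergent_def by blast
  have Yx: "(\<lambda>n. blinfun_apply (sqrt_iter X n) x) \<longlonglongrightarrow> blinfun_apply Y x" for x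
    by (intro blinfun.tendsto Y tendsto_const)
  have comp: "(\<lambda>n. A o\<^sub>L sqrt_iter X n) \<longlonglongrightarrow> (A o\<^sub>L Y)" "(\<lambda>n. sqrt_iter X n o\<^sub>L A) \<longlonglongrightarrow> (Y o\<^sub>L A)" for A
    by (intro bounded_bilinear.tendsto[OF bounded_bilinear_blinfun_compose] Y tendsto_const)+
  have Yb: "Y \<in> bounded_ops"
    unfolding bounded_ops_def
  proof (intro CollectI allI)
    fix c x
    have "(\<lambda>n. c *\<^sub>C blinfun_apply (sqrt_iter X n) x) \<longlonglongrightarrow> c *\<^sub>C blinfun_apply Y x"
      by (intro bounded_linear.tendsto[OF bounded_linear_scaleC_right] Yx)
    then have "(\<lambda>n. blinfun_apply (sqrt_iter X n) (c *\<^sub>C x)) \<longlonglongrightarrow> c *\<^sub>C blinfun_apply Y x"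
      by (simp add: bounded_opsD[OF sqrt_iter_bounded[OF Xb]])
    then show "blinfun_apply Y (c *\<^sub>C x) = c *\<^sub>C blinfun_apply Y x"
      using Yx LIMSEQ_unique by blast
  qed
  have Ys: "cinner x (blinfun_apply Y y) = cinner (blinfun_apply Y x) y" for x y
  proof -
    have "(\<lambda>n. cinner x (blinfun_apply (sqrt_iter X n) y)) \<longlonglongrightarrow> cinner x (blinfun_apply Y y)"
      by (intro bounded_linear.tendsto[OF bounded_linear_cinner_right] Yx)
    moreover have "(\<lambda>n. cinner (blinfun_apply (sqrt_iter X n) x) y) \<longlonglongrightarrow> cinner (blinfun_apply Y x) y"
      by (intro bounded_linear.tendsto[OF bounded_linear_cinner_left] Yx)
    ultimately show ?thesis
      unfolding sqrt_iter_symmetric[OF Xs] by (rule LIMSEQ_unique)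
  qed
  have Y1: "norm Y \<le> 1"
  proof (rule Lim_bounded[OF tendsto_norm[OF Y]])
    show "\<forall>n\<ge>0. norm (sqrt_iter X n) \<le> 1"
      using norm_sqrt_iter_le[OF X1] sqrt_bound_range by (meson order_trans)
  qed
  have Yfix: "Y = (1/2) *\<^sub>R (X + (Y o\<^sub>L Y))"
  proof -
    have "(\<lambda>n. sqrt_iter X (Suc n)) \<longlonglongrightarrow> (1/2) *\<^sub>R (X + (Y o\<^sub>L Y))"
      unfolding sqrt_iter.simps
      by (intro tendsto_scaleR tendsto_add tendsto_const bounded_bilinear.tendsto[OF bounded_bilinear_blinfun_compose] Y)
    moreover have "(\<lambda>n. sqrt_iter X (Suc n)) \<longlonglongrightarrow> Y" using Y by (rule LIMSEQ_Suc)
    ultimately show ?thesis using LIMSEQ_unique by blast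
  qed
  have Ycomm: "Z o\<^sub>L Y = Y o\<^sub>L Z" if "Z o\<^sub>L T = T o\<^sub>L Z" for Z
  proof -
    have "Z o\<^sub>L id_blinfun = Z" "id_blinfun o\<^sub>L Z = Z" by (auto intro: blinfun_eqI)
    then have \<open>Z o\<^sub>L X = X o\<^sub>L Z\<close> using that by (simp add: X_def compose_distribs)
    have "(\<lambda>n. sqrt_iter X n o\<^sub>L Z) = (\<lambda>n. Z o\<^sub>L sqrt_iter X n)"
      by (simp add: sqrt_iter_commute[OF \<open>Z o\<^sub>L X = X o\<^sub>L Z\<close>])
    then show ?thesis
      using LIMSEQ_unique[OF comp(1)[of Z]] comp(2)[of Z] by metis
  qed
  define S where "S = id_blinfun - Y"
  have "positive_op S"
  proof (rule positive_opI)
    show "S \<in> bounded_ops" using Yb by (simp add: S_def)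
    show "cinner x (blinfun_apply S y) = cinner (blinfun_apply S x) y" for x y
      by (simp add: S_def blinfun.diff_left cinner_simps Ys)
    fix x
    have "inner x (blinfun_apply Y x) \<le> norm x * norm (blinfun_apply Y x)" by (rule norm_cauchy_schwarz)
    also have "\<dots> \<le> norm x * norm x"
      using norm_blinfun[of Y x] mult_right_mono[OF Y1, of "norm x"] by (intro mult_left_mono) auto
    finally show "0 \<le> Re (cinner x (blinfun_apply S x))"
      by (simp add: S_def blinfun.diff_left cinner_diff_right cinner_self_Re inner_eq_Re_cinner power2_eq_square)
  qed
  moreover have "S o\<^sub>L S = T"
  proof -
    have "blinfun_apply X x + blinfun_apply Y (blinfun_apply Y x) = 2 *\<^sub>R blinfun_apply Y x" for x
      using arg_cong[OF Yfix, of "\<lambda>A. 2 *\<^sub>R blinfun_apply A x"]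
      by (simp add: blinfun.add_left blinfun.scaleR_left)
    then show ?thesis
      by (intro blinfun_eqI)
        (simp add: S_def X_def blinfun.diff_left blinfun.diff_right algebra_simps scaleR_2)
  qed
  moreover have "Z o\<^sub>L S = S o\<^sub>L Z" if "Z o\<^sub>L T = T o\<^sub>L Z" for Z
  proof -
    have "Z o\<^sub>L id_blinfun = Z" "id_blinfun o\<^sub>L Z = Z" by (auto intro: blinfun_eqI)
    then show ?thesis using Ycomm[OF that] by (simp add: S_def compose_distribs)
  qed
  ultimately show ?thesis using that by blast
qed

lemma positive_op_scaleR: "positive_op T \<Longrightarrow> 0 \<le> r \<Longrightarrow> positive_op (r *\<^sub>R T)"
  by (rule positive_opI)
    (simp_all add: positive_op_bounded blinfun.scaleR_left cinner_scaleR_left cinner_scaleR_right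
      positive_op_Re, metis positive_op_symmetric)

text \<open>Rescaling by \<open>\<parallel>T\<parallel> + 1\<close> rather than \<open>\<parallel>T\<parallel>\<close> avoids a case distinction for \<open>T = 0\<close>.\<close>
lemma positive_sqrt_exists:
  fixes T :: "'h::chilbert_space operator"
  assumes T: "positive_op T"
  obtains S where "positive_op S" "S o\<^sub>L S = T" "\<And>Z. Z o\<^sub>L T = T o\<^sub>L Z \<Longrightarrow> Z o\<^sub>L S = S o\<^sub>L Z"
proof -
  define k where "k = norm T + 1"
  have k: "k > 0" by (simp add: k_def add_nonneg_pos)
  have "positive_op ((1/k) *\<^sub>R T)" using T k by (intro positive_op_scaleR) auto
  moreover have "norm ((1/k) *\<^sub>R T) \<le> 1" using k by (simp add: k_def)
  ultimately obtain S where S: "positive_op S" "S o\<^sub>L S = (1/k) *\<^sub>R T"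
    "\<And>Z. Z o\<^sub>L ((1/k) *\<^sub>R T) = ((1/k) *\<^sub>R T) o\<^sub>L Z \<Longrightarrow> Z o\<^sub>L S = S o\<^sub>L Z"
    by (rule positive_sqrt_contraction) blast
  show ?thesis
  proof (rule that[of "sqrt k *\<^sub>R S"])
    show "positive_op (sqrt k *\<^sub>R S)" using S(1) k by (intro positive_op_scaleR) auto
    show "sqrt k *\<^sub>R S o\<^sub>L sqrt k *\<^sub>R S = T" using k by (simp add: compose_distribs S(2))
    show "Z o\<^sub>L sqrt k *\<^sub>R S = sqrt k *\<^sub>R S o\<^sub>L Z" if "Z o\<^sub>L T = T o\<^sub>L Z" for Z
      using S(3)[of Z] that by (simp add: compose_distribs)
  qed
qed

lemma positive_sqrt_unique:
  fixes P S :: "'h::chilbert_space operator"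
  assumes P: "positive_op P" and Q: "positive_op Q" and eq: "P o\<^sub>L P = Q o\<^sub>L Q"
  shows "P = Q"
proof -
  have "positive_op (Q o\<^sub>L Q)"
    using positive_op_square[OF positive_op_bounded[OF Q]] by (simp add: positive_op_adjoint[OF Q])
  then obtain S where S: "positive_op S" "S o\<^sub>L S = Q o\<^sub>L Q"
    "\<And>Z. Z o\<^sub>L (Q o\<^sub>L Q) = (Q o\<^sub>L Q) o\<^sub>L Z \<Longrightarrow> Z o\<^sub>L S = S o\<^sub>L Z"
    by (rule positive_sqrt_exists) blast
  \<comment> \<open>every positive root \<open>Z\<close> commutes with its square, hence with \<open>S\<close>; so \<open>(Z + S)(Z - S) = 0\<close>\<close>
  have "Z = S" if Z: "positive_op Z" and ZZ: "Z o\<^sub>L Z = Q o\<^sub>L Q" for Z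
  proof (rule blinfun_eqI)
    fix x
    have "Z o\<^sub>L S = S o\<^sub>L Z" using S(3)[of Z] by (simp flip: ZZ add: compose_assoc)
    then have c: "blinfun_apply Z (blinfun_apply S x) = blinfun_apply S (blinfun_apply Z x)"
      by (metis blinfun_apply_blinfun_compose)
    have sq: "blinfun_apply Z (blinfun_apply Z x) = blinfun_apply S (blinfun_apply S x)"
      by (metis S(2) ZZ blinfun_apply_blinfun_compose)
    define y where "y = blinfun_apply Z x - blinfun_apply S x"
    have "blinfun_apply Z y + blinfun_apply S y = 0"
      by (simp add: y_def blinfun.diff_right c sq)
    then have "Re (cinner y (blinfun_apply Z y)) + Re (cinner y (blinfun_apply S y)) = 0"
      by (metis cinner_add_right cinner_zero_right plus_complex.sel(1) zero_complex.sel(1))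
    then have z: "Re (cinner y (blinfun_apply Z y)) = 0" "Re (cinner y (blinfun_apply S y)) = 0"
      using positive_op_Re[OF Z, of y] positive_op_Re[OF S(1), of y] by linarith+
    have "blinfun_apply Z y = 0" "blinfun_apply S y = 0"
      using positive_op_norm_le[OF Z, of y] positive_op_norm_le[OF S(1), of y] by (simp_all add: z)
    then have "cinner y y = 0"
      unfolding y_def cinner_diff_left
      by (simp flip: y_def positive_op_symmetric[OF Z] positive_op_symmetric[OF S(1)])
    then show "blinfun_apply Z x = blinfun_apply S x" by (simp add: cinner_self y_def)
  qed
  then show ?thesis using P Q eq by metis
qed

lemma abs_op:
  assumes A: "A \<in> bounded_ops"
  shows abs_op_positive: "positive_op (abs_op A)"
    and abs_op_square: "abs_op A o\<^sub>L abs_op A = adjoint_op A o\<^sub>L A"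
proof -
  obtain S where S: "positive_op S" "S o\<^sub>L S = adjoint_op A o\<^sub>L A"
    by (rule positive_sqrt_exists[OF positive_op_square[OF A]])
  have "positive_op (abs_op A) \<and> abs_op A o\<^sub>L abs_op A = adjoint_op A o\<^sub>L A"
    unfolding abs_op_def
  proof (rule theI[of _ S])
    fix P assume "positive_op P \<and> P o\<^sub>L P = adjoint_op A o\<^sub>L A"
    with S show "P = S" by (metis positive_sqrt_unique)
  qed (use S in blast)
  then show "positive_op (abs_op A)" "abs_op A o\<^sub>L abs_op A = adjoint_op A o\<^sub>L A" by auto
qed

lemma abs_op_positive_eq: "positive_op P \<Longrightarrow> abs_op P = P"
  by (rule positive_sqrt_unique)
    (simp_all add: abs_op_positive abs_op_square positive_op_bounded positive_op_adjoint)

lemma norm_abs_op: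
  assumes A: "A \<in> bounded_ops"
  shows "norm (blinfun_apply (abs_op A) x) = norm (blinfun_apply A x)"
proof -
  have "cinner (blinfun_apply (abs_op A) x) (blinfun_apply (abs_op A) x) = cinner x (blinfun_apply (abs_op A o\<^sub>L abs_op A) x)"
    by (simp add: positive_op_symmetric[OF abs_op_positive[OF A]])
  also have "\<dots> = cinner (blinfun_apply A x) (blinfun_apply A x)"
    by (simp add: abs_op_square[OF A] cinner_adjoint_right[OF A])
  finally have "(norm (blinfun_apply (abs_op A) x))\<^sup>2 = (norm (blinfun_apply A x))\<^sup>2"
    unfolding cinner_self of_real_eq_iff .
  then show ?thesis by (simp add: power2_eq_iff_nonneg)
qed

text \<open>
  Since \<open>\<parallel>A x\<parallel> = \<parallel>\<bar>A\<bar> x\<parallel>\<close>, each of \<open>A\<close> and \<open>\<bar>A\<bar>\<close> is a bounded operator times the other. These two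
  factorizations are the form in which the polar decomposition enters the theory of the trace class.
\<close>
lemma polar_decomposition:
  assumes A: "A \<in> bounded_ops"
  obtains U where "U \<in> bounded_ops" "A = U o\<^sub>L abs_op A"
  by (rule douglas_factorization[OF A positive_op_bounded[OF abs_op_positive[OF A]]])
    (simp_all add: norm_abs_op[OF A] that)

lemma abs_op_factorization:
  assumes A: "A \<in> bounded_ops"
  obtains V where "V \<in> bounded_ops" "abs_op A = V o\<^sub>L A"
  by (rule douglas_factorization[OF positive_op_bounded[OF abs_op_positive[OF A]] A])
    (simp_all add: norm_abs_op[OF A] that)

section \<open>Hilbert bases and the Parseval identity\<close>

lemma cinner_polarization:
  "4 * cinner x y = of_real ((norm (x + y))\<^sup>2) - of_real ((norm (x - y))\<^sup>2)
    - \<i> * of_real ((norm (x + \<i> *\<^sub>C y))\<^sup>2) + \<i> * of_real ((norm (x - \<i> *\<^sub>C y))\<^sup>2)"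
  unfolding cinner_self[symmetric]
  by (simp add: cinner_simps algebra_simps)

text \<open>Zorn's lemma; normalizing a vector orthogonal to a maximal orthonormal set would enlarge it.\<close>
lemma onb_exists: "\<exists>E :: 'h::chilbert_space set. onb E"
proof -
  define orthonormal :: "'h set \<Rightarrow> bool" where
    "orthonormal E \<longleftrightarrow> (\<forall>e\<in>E. norm e = 1) \<and> (\<forall>e\<in>E. \<forall>f\<in>E. e \<noteq> f \<longrightarrow> cinner e f = 0)" for E
  have "\<exists>M\<in>{E. orthonormal E}. \<forall>X\<in>{E. orthonormal E}. M \<subseteq> X \<longrightarrow> X = M"
  proof (rule subset_Zorn', intro CollectI)
    fix C assume C: "subset.chain {E. orthonormal E} C"
    then have sub: "\<And>E. E \<in> C \<Longrightarrow> orthonormal E" and tot: "\<And>E F. E \<in> C \<Longrightarrow> F \<in> C \<Longrightarrow> E \<subseteq> F \<or> F \<subseteq> E"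
      by (auto simp: subset_chain_def)
    show "orthonormal (\<Union>C)"
      unfolding orthonormal_def
    proof (intro conjI ballI impI)
      fix e assume "e \<in> \<Union>C" then show "norm e = 1" using sub by (auto simp: orthonormal_def)
    next
      fix e f assume "e \<in> \<Union>C" "f \<in> \<Union>C" and ne: "e \<noteq> f"
      then obtain E F where E: "E \<in> C" "e \<in> E" and F: "F \<in> C" "f \<in> F" by blast
      from tot[OF E(1) F(1)] show "cinner e f = 0"
        using sub[OF E(1)] sub[OF F(1)] E(2) F(2) ne unfolding orthonormal_def by (elim disjE) blast+
    qed
  qed
  then obtain M where M: "orthonormal M" and max: "\<And>X. orthonormal X \<Longrightarrow> M \<subseteq> X \<Longrightarrow> X = M" by blast
  have "x = 0" if x: "\<forall>e\<in>M. cinner e x = 0" for x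
  proof (rule ccontr)
    assume nz: "x \<noteq> 0"
    define u where "u = (1 / norm x) *\<^sub>R x"
    have u1: "norm u = 1" using nz by (simp add: u_def)
    have u0: "cinner e u = 0" if "e \<in> M" for e using x that by (simp add: u_def cinner_scaleR_right)
    then have u0': "cinner u e = 0" if "e \<in> M" for e using that by (subst cinner_commute) simp
    have "orthonormal (insert u M)"
      using M u0 u0' u1 unfolding orthonormal_def by auto
    then have "u \<in> M" using max[of "insert u M"] by blast
    then have "cinner u u = 0" by (rule u0)
    then show False using u1 by (simp add: cinner_self)
  qed
  then have "onb M" using M by (simp add: onb_def orthonormal_def)
  then show ?thesis by blast
qed

lemma onb_cinner:
  "onb E \<Longrightarrow> e \<in> E \<Longrightarrow> f \<in> E \<Longrightarrow> cinner e f = (if e = f then 1 else 0)"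
  by (auto simp: onb_def cinner_self)

lemma onb_projection:
  assumes E: "onb E" and F: "finite F" "F \<subseteq> E"
  defines "p \<equiv> \<lambda>x. \<Sum>e\<in>F. cinner e x *\<^sub>C e"
  shows cinner_onb_projection: "e \<in> F \<Longrightarrow> cinner e (x - p x) = 0"
    and norm_onb_projection: "(norm (x - p x))\<^sup>2 = (norm x)\<^sup>2 - (\<Sum>e\<in>F. (norm (cinner e x))\<^sup>2)"
proof -
  show orth: "cinner e (x - p x) = 0" if e: "e \<in> F" for e
  proof -
    have "cinner e (p x) = (\<Sum>f\<in>F. cinner f x * (if e = f then 1 else 0))"
      unfolding p_def cinner_sum_right cinner_scaleC_right
      by (intro sum.cong refl) (use e F(2) in \<open>simp add: onb_cinner[OF E] subset_iff\<close>)
    also have "\<dots> = (\<Sum>f\<in>F. if e = f then cinner e x else 0)" by (rule sum.cong) auto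
    also have "\<dots> = cinner e x" using e F(1) by (simp add: sum.delta)
    finally show ?thesis by (simp add: cinner_diff_right)
  qed
  have "cinner (p x) (x - p x) = 0"
    unfolding p_def cinner_sum_left cinner_scaleC_left
    by (intro sum.neutral ballI) (use orth p_def in simp)
  then have "cinner (x - p x) (x - p x) = cinner x (x - p x)"
    by (simp add: cinner_diff_left)
  also have "\<dots> = cinner x x - (\<Sum>e\<in>F. cinner e x * cinner x e)"
    by (simp add: p_def cinner_diff_right cinner_sum_right cinner_scaleC_right)
  also have "\<dots> = cinner x x - (\<Sum>e\<in>F. of_real ((norm (cinner e x))\<^sup>2))"
    by (intro arg_cong2[where f = minus] sum.cong refl) (metis cinner_commute complex_norm_square)
  finally have "complex_of_real ((norm (x - p x))\<^sup>2) = of_real ((norm x)\<^sup>2 - (\<Sum>e\<in>F. (norm (cinner e x))\<^sup>2))"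
    by (simp add: cinner_self)
  then show "(norm (x - p x))\<^sup>2 = (norm x)\<^sup>2 - (\<Sum>e\<in>F. (norm (cinner e x))\<^sup>2)"
    by (simp only: of_real_eq_iff)
qed

text \<open>
  The vectors supported on finitely many basis elements form a subspace \<open>M\<close>; support is expressed by
  orthogonality, so that no coefficients have to be manipulated. The projection of \<open>x\<close> to
  the closure of \<open>M\<close> is \<open>x\<close> itself by maximality of the basis, so some \<open>m\<close> in \<open>M\<close> is close to \<open>x\<close>, and the partial
  Fourier sum over the support of \<open>m\<close> is at least as close.
\<close>
lemma onb_finite_approximation:
  fixes E :: "'h::chilbert_space set"
  assumes E: "onb E" and d: "d > 0"
  obtains F where "finite F" "F \<subseteq> E" "norm (x - (\<Sum>e\<in>F. cinner e x *\<^sub>C e)) < d"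
proof -
  define M where "M = {m. \<exists>F. finite F \<and> F \<subseteq> E \<and> (\<forall>z. (\<forall>e\<in>F. cinner e z = 0) \<longrightarrow> cinner m z = 0)}"
  have M0: "subspace M"
    unfolding subspace_def
  proof (intro conjI ballI allI)
    show "0 \<in> M" unfolding M_def by (intro CollectI exI[of _ "{}"]) simp
    fix m n assume "m \<in> M" "n \<in> M"
    then obtain F G where "finite F" "F \<subseteq> E" "\<And>z. (\<forall>e\<in>F. cinner e z = 0) \<Longrightarrow> cinner m z = 0"
      and "finite G" "G \<subseteq> E" "\<And>z. (\<forall>e\<in>G. cinner e z = 0) \<Longrightarrow> cinner n z = 0"
      unfolding M_def by blast
    then show "m + n \<in> M" unfolding M_def
      by (intro CollectI exI[of _ "F \<union> G"]) (simp add: cinner_add_left)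
  next
    fix r :: real and m assume "m \<in> M"
    then show "r *\<^sub>R m \<in> M" unfolding M_def by (force simp: cinner_scaleR_left)
  qed
  have EM: "c *\<^sub>C e \<in> M" if "e \<in> E" for c e
    unfolding M_def using that by (intro CollectI exI[of _ "{e}"]) (simp add: cinner_scaleC_left)
  obtain v where v: "v \<in> closure ((\<lambda>m. m) ` M)" "\<And>m. m \<in> M \<Longrightarrow> inner x m = inner v m"
  proof (rule riesz_subspace[OF M0 linear_ident, where g = "inner x" and C = "norm x"])
    show "linear (inner x)" by (simp add: bounded_linear.linear bounded_linear_inner_right)
  qed (auto simp: Cauchy_Schwarz_ineq2)
  have "cinner e (x - v) = 0" if "e \<in> E" for e
  proof -
    have "inner (c *\<^sub>C e) (x - v) = 0" for c
      using v(2)[OF EM[OF that, of c]] by (simp add: inner_diff_right inner_commute)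
    from this[of 1] this[of \<i>] show ?thesis
      by (simp add: complex_eq_iff inner_eq_Re_cinner Im_cinner)
  qed
  then have "x = v" using E unfolding onb_def by (metis eq_iff_diff_eq_0)
  then have "x \<in> closure M" using v(1) by simp
  then obtain m where m: "m \<in> M" "dist m x < d" using d closure_approachable by metis
  then obtain F where F: "finite F" "F \<subseteq> E" "\<And>z. (\<forall>e\<in>F. cinner e z = 0) \<Longrightarrow> cinner m z = 0"
    unfolding M_def by blast
  define z where "z = x - (\<Sum>e\<in>F. cinner e x *\<^sub>C e)"
  have z0: "cinner e z = 0" if "e \<in> F" for e
    unfolding z_def by (rule cinner_onb_projection[OF E F(1,2) that])
  then have "cinner m z = 0" by (rule F(3)[rule_format]) simp
  moreover have "cinner (\<Sum>e\<in>F. cinner e x *\<^sub>C e) z = 0"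
    by (simp add: cinner_sum_left cinner_scaleC_left z0)
  ultimately have "cinner z z = cinner (x - m) z"
    by (subst (1) z_def) (simp add: cinner_diff_left)
  then have "norm z * norm z = norm (cinner (x - m) z)"
    by (metis cinner_self norm_of_real abs_of_nonneg zero_le_power2 power2_eq_square)
  also have "\<dots> \<le> norm (x - m) * norm z" by (rule Cauchy_Schwarz_cinner)
  finally have "norm z \<le> norm (x - m)" by (cases "norm z = 0") auto
  also have "\<dots> < d" using m(2) by (simp add: dist_norm norm_minus_commute)
  finally show ?thesis using that F(1,2) by (simp add: z_def)
qed

text \<open>
  Partial sums are at most \<open>\<parallel>x\<parallel>\<^sup>2\<close> (Bessel), and come close to it since the squared error of a partial Fourier
  sum is exactly the defect.
\<close>
lemma parseval_norm:
  assumes E: "onb E"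
  shows "((\<lambda>e. (norm (cinner e x))\<^sup>2) has_sum (norm x)\<^sup>2) E"
  unfolding has_sum_def
proof (rule order_tendstoI)
  let ?s = "sum (\<lambda>e. (norm (cinner e x))\<^sup>2)"
  have bessel: "?s F \<le> (norm x)\<^sup>2" if "finite F" "F \<subseteq> E" for F
    using norm_onb_projection[OF E that, of x] by (smt (verit) zero_le_power2)
  show "\<forall>\<^sub>F F in finite_subsets_at_top E. ?s F < a" if "(norm x)\<^sup>2 < a" for a
    using bessel that by (intro eventually_finite_subsets_at_top_weakI) (meson le_less_trans)
  show "\<forall>\<^sub>F F in finite_subsets_at_top E. a < ?s F" if a: "a < (norm x)\<^sup>2" for a
  proof -
    define d where "d = sqrt ((norm x)\<^sup>2 - a)"
    have d: "d > 0" "d\<^sup>2 = (norm x)\<^sup>2 - a" using a by (simp_all add: d_def)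
    obtain F where F: "finite F" "F \<subseteq> E" "norm (x - (\<Sum>e\<in>F. cinner e x *\<^sub>C e)) < d"
      by (rule onb_finite_approximation[OF E d(1)])
    have "(norm x)\<^sup>2 - ?s F < (norm x)\<^sup>2 - a"
      using power_strict_mono[OF F(3), of 2] by (simp add: norm_onb_projection[OF E F(1,2)] d(2))
    then have "a < ?s F" by simp
    then show ?thesis
      unfolding eventually_finite_subsets_at_top
      using F(1,2) by (intro exI[of _ F]) (auto intro!: sum_mono2 elim!: less_le_trans)
  qed
qed

text \<open>Polarization of the norm identity, both in the Hilbert space and in each coordinate.\<close>
lemma parseval:
  assumes E: "onb E"
  shows "((\<lambda>e. cinner x e * cinner e y) has_sum cinner x y) E"
proof -
  let ?n = "\<lambda>z. complex_of_real ((norm z)\<^sup>2)"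
  have N: "((\<lambda>e. complex_of_real ((norm (cinner e z))\<^sup>2)) has_sum ?n z) E" for z
    by (rule has_sum_of_real[OF parseval_norm[OF E]])
  have "((\<lambda>e. (1/4) * (of_real ((norm (cinner e (x + y)))\<^sup>2) + (- 1) * of_real ((norm (cinner e (x - y)))\<^sup>2)
      + (- \<i>) * of_real ((norm (cinner e (x + \<i> *\<^sub>C y)))\<^sup>2) + \<i> * of_real ((norm (cinner e (x - \<i> *\<^sub>C y)))\<^sup>2)))
    has_sum ((1/4) * (?n (x + y) + (- 1) * ?n (x - y) + (- \<i>) * ?n (x + \<i> *\<^sub>C y) + \<i> * ?n (x - \<i> *\<^sub>C y)))) E"
    by (intro has_sum_add has_sum_cmult_right N)
  also have "(\<lambda>e. (1/4) * (of_real ((norm (cinner e (x + y)))\<^sup>2) + (- 1) * of_real ((norm (cinner e (x - y)))\<^sup>2)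
      + (- \<i>) * of_real ((norm (cinner e (x + \<i> *\<^sub>C y)))\<^sup>2) + \<i> * of_real ((norm (cinner e (x - \<i> *\<^sub>C y)))\<^sup>2)))
    = (\<lambda>e. cinner x e * cinner e y)"
  proof
    fix e
    have "4 * (cinner x e * cinner e y) = 4 * cinner (cinner e x) (cinner e y)"
      by (simp add: cinner_complex_def flip: cinner_commute)
    also have "\<dots> = of_real ((norm (cinner e (x + y)))\<^sup>2) + (- 1) * of_real ((norm (cinner e (x - y)))\<^sup>2)
      + (- \<i>) * of_real ((norm (cinner e (x + \<i> *\<^sub>C y)))\<^sup>2) + \<i> * of_real ((norm (cinner e (x - \<i> *\<^sub>C y)))\<^sup>2)"
      unfolding cinner_polarization[of "cinner e x" "cinner e y"]
      by (simp add: cinner_simps scaleC_complex_def)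
    finally show "(1/4) * (of_real ((norm (cinner e (x + y)))\<^sup>2) + (- 1) * of_real ((norm (cinner e (x - y)))\<^sup>2)
      + (- \<i>) * of_real ((norm (cinner e (x + \<i> *\<^sub>C y)))\<^sup>2) + \<i> * of_real ((norm (cinner e (x - \<i> *\<^sub>C y)))\<^sup>2))
      = cinner x e * cinner e y" by (simp add: mult.commute)
  qed
  also have "(1/4) * (?n (x + y) + (- 1) * ?n (x - y) + (- \<i>) * ?n (x + \<i> *\<^sub>C y) + \<i> * ?n (x - \<i> *\<^sub>C y))
    = cinner x y"
    using cinner_polarization[of x y] by (simp add: mult.commute)
  finally show ?thesis .
qed

section \<open>Hilbert--Schmidt operators\<close>

definition hilbert_schmidt :: "'h::chilbert_space operator \<Rightarrow> bool"
  where "hilbert_schmidt T \<longleftrightarrow>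
    T \<in> bounded_ops \<and> (\<exists>E. onb E \<and> (\<lambda>e. (norm (blinfun_apply T e))\<^sup>2) summable_on E)"

lemma hilbert_schmidt_bounded [simp, intro]: "hilbert_schmidt T \<Longrightarrow> T \<in> bounded_ops"
  by (simp add: hilbert_schmidt_def)

lemma matrix_summable:
  assumes E: "onb E" and F: "onb F" and sum: "(\<lambda>e. (norm (blinfun_apply T e))\<^sup>2) summable_on E"
  shows "(\<lambda>(e, f). (norm (cinner f (blinfun_apply T e)))\<^sup>2) summable_on E \<times> F"
  by (rule summable_on_SigmaI[OF _ sum]) (simp_all add: parseval_norm[OF F])

text \<open>
  Both sums are the sum of \<open>\<bar>\<langle>f, T e\<rangle>\<bar>\<^sup>2\<close> over all matrix entries. Applied twice, this shows that
  summability does not depend on the basis.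
\<close>
lemma adjoint_summable:
  assumes T: "T \<in> bounded_ops" and E: "onb E" and F: "onb F"
    and sum: "(\<lambda>e. (norm (blinfun_apply T e))\<^sup>2) summable_on E"
  shows "(\<lambda>f. (norm (blinfun_apply (adjoint_op T) f))\<^sup>2) summable_on F"
proof -
  have hs: "((\<lambda>e. (norm (cinner f (blinfun_apply T e)))\<^sup>2) has_sum (norm (blinfun_apply (adjoint_op T) f))\<^sup>2) E" for f
    using parseval_norm[OF E, of "blinfun_apply (adjoint_op T) f"]
    unfolding cinner_adjoint_right[OF T] by (subst cinner_commute) simp
  have "(\<lambda>(f, e). (norm (cinner f (blinfun_apply T e)))\<^sup>2) summable_on F \<times> E"
    using matrix_summable[OF E F sum]
    by (subst summable_on_swap) (simp add: case_prod_unfold)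
  then have "(\<lambda>f. infsum (\<lambda>e. case (f, e) of (f, e) \<Rightarrow> (norm (cinner f (blinfun_apply T e)))\<^sup>2) E) summable_on F"
    by (rule summable_on_SigmaD) (use hs has_sum_imp_summable in fastforce)
  then show ?thesis using infsumI[OF hs] by simp
qed

lemma hilbert_schmidt_adjoint:
  assumes "hilbert_schmidt T" shows "hilbert_schmidt (adjoint_op T)"
  using assms adjoint_summable unfolding hilbert_schmidt_def by blast

lemma hilbert_schmidt_summable:
  assumes "hilbert_schmidt T" and F: "onb F"
  shows "(\<lambda>e. (norm (blinfun_apply T e))\<^sup>2) summable_on F"
proof -
  obtain E where T: "T \<in> bounded_ops" and E: "onb E" "(\<lambda>e. (norm (blinfun_apply T e))\<^sup>2) summable_on E"
    using assms by (auto simp: hilbert_schmidt_def)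
  have "(\<lambda>f. (norm (blinfun_apply (adjoint_op (adjoint_op T)) f))\<^sup>2) summable_on F"
    by (rule adjoint_summable[OF _ E(1) F adjoint_summable[OF T E(1) E]]) (use T in simp)
  then show ?thesis using T by simp
qed

lemma hilbert_schmidt_compose_left:
  assumes A: "A \<in> bounded_ops" and T: "hilbert_schmidt T"
  shows "hilbert_schmidt (A o\<^sub>L T)"
proof -
  obtain E where E: "onb E" "(\<lambda>e. (norm (blinfun_apply T e))\<^sup>2) summable_on E"
    using T by (auto simp: hilbert_schmidt_def)
  have "(\<lambda>e. (norm (blinfun_apply (A o\<^sub>L T) e))\<^sup>2) summable_on E"
  proof (rule summable_on_comparison_test[OF summable_on_cmult_right[OF E(2), of "(norm A)\<^sup>2"]])
    fix e
    show "(norm (blinfun_apply (A o\<^sub>L T) e))\<^sup>2 \<le> (norm A)\<^sup>2 * (norm (blinfun_apply T e))\<^sup>2"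
      using power_mono[OF norm_blinfun[of A "blinfun_apply T e"], of 2] by (simp add: power_mult_distrib)
  qed simp
  then show ?thesis using A T E(1) by (auto simp: hilbert_schmidt_def)
qed

lemma hilbert_schmidt_compose_right:
  assumes A: "A \<in> bounded_ops" and T: "hilbert_schmidt T"
  shows "hilbert_schmidt (T o\<^sub>L A)"
proof -
  have "hilbert_schmidt (adjoint_op (adjoint_op A o\<^sub>L adjoint_op T))"
    using A T by (intro hilbert_schmidt_adjoint hilbert_schmidt_compose_left) auto
  then show ?thesis using A T by (simp add: adjoint_compose)
qed

lemma hilbert_schmidt_scaleC:
  assumes T: "hilbert_schmidt T"
  shows "hilbert_schmidt (c *\<^sub>C T)"
proof -
  have "c *\<^sub>C T = (c *\<^sub>C id_blinfun) o\<^sub>L T" by (rule blinfun_eqI) simp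
  then show ?thesis using T by (simp add: hilbert_schmidt_compose_left)
qed

lemma hilbert_schmidt_add:
  assumes S: "hilbert_schmidt S" and T: "hilbert_schmidt T"
  shows "hilbert_schmidt (S + T)"
proof -
  obtain E :: "'a set" where E: "onb E" using onb_exists by blast
  have "(\<lambda>e. (norm (blinfun_apply (S + T) e))\<^sup>2) summable_on E"
  proof (rule summable_on_comparison_test)
    show "(\<lambda>e. 2 * ((norm (blinfun_apply S e))\<^sup>2 + (norm (blinfun_apply T e))\<^sup>2)) summable_on E"
      by (intro summable_on_cmult_right summable_on_add hilbert_schmidt_summable S T E)
    fix e
    have "(norm (blinfun_apply (S + T) e))\<^sup>2 \<le> (norm (blinfun_apply S e) + norm (blinfun_apply T e))\<^sup>2"
      by (intro power_mono) (simp_all add: blinfun.add_left norm_triangle_ineq)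
    also have "\<dots> \<le> 2 * ((norm (blinfun_apply S e))\<^sup>2 + (norm (blinfun_apply T e))\<^sup>2)"
      using sum_squares_bound[of "norm (blinfun_apply S e)" "norm (blinfun_apply T e)"]
      by (simp add: power2_sum)
    finally show "(norm (blinfun_apply (S + T) e))\<^sup>2 \<le> 2 * ((norm (blinfun_apply S e))\<^sup>2 + (norm (blinfun_apply T e))\<^sup>2)" .
  qed simp
  then show ?thesis using S T E by (auto simp: hilbert_schmidt_def)
qed

lemma hilbert_schmidt_pairing_summable:
  assumes B: "hilbert_schmidt B" and C: "hilbert_schmidt C" and E: "onb E"
  shows "(\<lambda>e. cinner (blinfun_apply B e) (blinfun_apply C e)) summable_on E"
proof (rule abs_summable_summable, rule Infinite_Sum.abs_summable_on_comparison_test')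
  show "(\<lambda>e. (norm (blinfun_apply B e))\<^sup>2 + (norm (blinfun_apply C e))\<^sup>2) summable_on E"
    by (intro summable_on_add hilbert_schmidt_summable B C E)
  fix e
  have "norm (cinner (blinfun_apply B e) (blinfun_apply C e)) \<le> norm (blinfun_apply B e) * norm (blinfun_apply C e)"
    by (rule Cauchy_Schwarz_cinner)
  also have "\<dots> \<le> (norm (blinfun_apply B e))\<^sup>2 + (norm (blinfun_apply C e))\<^sup>2"
    using sum_squares_bound[of "norm (blinfun_apply B e)" "norm (blinfun_apply C e)"]
      mult_nonneg_nonneg[OF norm_ge_zero[of "blinfun_apply B e"] norm_ge_zero[of "blinfun_apply C e"]] by linarith
  finally show "norm (cinner (blinfun_apply B e) (blinfun_apply C e)) \<le> (norm (blinfun_apply B e))\<^sup>2 + (norm (blinfun_apply C e))\<^sup>2" .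
qed

text \<open>
  Expanding \<open>\<langle>B e, C e\<rangle>\<close> in the basis \<open>F\<close> gives an absolutely convergent double series; summing it in
  the other order produces the adjoints. As \<open>E\<close> and \<open>F\<close> are unrelated, the left-hand side does not
  depend on \<open>E\<close>; this is the source of basis independence and of cyclicity of the trace.
\<close>
lemma hilbert_schmidt_pairing_swap:
  assumes B: "hilbert_schmidt B" and C: "hilbert_schmidt C" and E: "onb E" and F: "onb F"
  shows "(\<Sum>\<^sub>\<infinity>e\<in>E. cinner (blinfun_apply B e) (blinfun_apply C e))
    = (\<Sum>\<^sub>\<infinity>f\<in>F. cinner (blinfun_apply (adjoint_op C) f) (blinfun_apply (adjoint_op B) f))"
proof -
  let ?a = "\<lambda>e f. cinner (blinfun_apply B e) f * cinner f (blinfun_apply C e)"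
  have "(\<lambda>x. norm (case x of (e, f) \<Rightarrow> ?a e f)) summable_on E \<times> F"
  proof (rule Infinite_Sum.abs_summable_on_comparison_test')
    show "(\<lambda>x. (case x of (e, f) \<Rightarrow> (norm (cinner f (blinfun_apply B e)))\<^sup>2)
        + (case x of (e, f) \<Rightarrow> (norm (cinner f (blinfun_apply C e)))\<^sup>2)) summable_on E \<times> F"
      by (intro summable_on_add matrix_summable hilbert_schmidt_summable B C E F)
    fix x :: "'a \<times> 'a" obtain e f where x: "x = (e, f)" by force
    have "norm (?a e f) = norm (cinner f (blinfun_apply B e)) * norm (cinner f (blinfun_apply C e))"
      by (simp add: norm_mult) (metis cinner_commute complex_mod_cnj)
    also have "\<dots> \<le> (norm (cinner f (blinfun_apply B e)))\<^sup>2 + (norm (cinner f (blinfun_apply C e)))\<^sup>2"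
      using sum_squares_bound[of "norm (cinner f (blinfun_apply B e))" "norm (cinner f (blinfun_apply C e))"]
        mult_nonneg_nonneg[OF norm_ge_zero[of "cinner f (blinfun_apply B e)"] norm_ge_zero[of "cinner f (blinfun_apply C e)"]]
      by linarith
    finally show "norm (case x of (e, f) \<Rightarrow> ?a e f) \<le> (case x of (e, f) \<Rightarrow> (norm (cinner f (blinfun_apply B e)))\<^sup>2)
        + (case x of (e, f) \<Rightarrow> (norm (cinner f (blinfun_apply C e)))\<^sup>2)" by (simp add: x)
  qed
  then have "(\<lambda>(e, f). ?a e f) summable_on E \<times> F" by (rule abs_summable_summable)
  then have "infsum (\<lambda>e. infsum (?a e) F) E = infsum (\<lambda>f. infsum (\<lambda>e. ?a e f) E) F"
    by (rule infsum_swap_banach)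
  moreover have "infsum (?a e) F = cinner (blinfun_apply B e) (blinfun_apply C e)" for e
    by (rule infsumI, rule parseval[OF F])
  moreover have "infsum (\<lambda>e. ?a e f) E = cinner (blinfun_apply (adjoint_op C) f) (blinfun_apply (adjoint_op B) f)" for f
    using infsumI[OF parseval[OF E, of "blinfun_apply (adjoint_op C) f" "blinfun_apply (adjoint_op B) f"]]
    by (simp add: cinner_adjoint_left cinner_adjoint_right B C mult.commute)
  ultimately show ?thesis by simp
qed

section \<open>Trace class operators and the trace\<close>

lemma trace_class_bounded [simp, intro]: "T \<in> trace_class \<Longrightarrow> T \<in> bounded_ops"
  by (simp add: trace_class_def)

lemma positive_trace_class_root:
  assumes R: "positive_op R" "R o\<^sub>L R = P"
    and E: "onb E" "(\<lambda>e. cinner e (blinfun_apply P e)) summable_on E"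
  shows "hilbert_schmidt R"
proof -
  have "cinner e (blinfun_apply P e) = of_real ((norm (blinfun_apply R e))\<^sup>2)" for e
    unfolding R(2)[symmetric] by (simp add: positive_op_symmetric[OF R(1)] cinner_self)
  then have "(\<lambda>e. Re (of_real ((norm (blinfun_apply R e))\<^sup>2))) summable_on E"
    using summable_on_Re[OF E(2)] by simp
  then show ?thesis using E(1) positive_op_bounded[OF R(1)] by (auto simp: hilbert_schmidt_def)
qed

text \<open>
  With the polar decomposition \<open>T = U \<bar>T\<bar>\<close> and \<open>R = \<bar>T\<bar>\<^sup>1\<^sup>/\<^sup>2\<close>, which is Hilbert--Schmidt because
  \<open>\<langle>e, \<bar>T\<bar> e\<rangle> = \<parallel>R e\<parallel>\<^sup>2\<close>, the factorization is \<open>T = (U R) R\<close>.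
\<close>
lemma trace_class_factor:
  assumes T: "T \<in> trace_class"
  obtains B C where "hilbert_schmidt B" "hilbert_schmidt C" "T = adjoint_op B o\<^sub>L C"
proof -
  from T obtain E where Tb: "T \<in> bounded_ops" and E: "onb E" "(\<lambda>e. cinner e (blinfun_apply (abs_op T) e)) summable_on E"
    unfolding trace_class_def by blast
  obtain R where R: "positive_op R" "R o\<^sub>L R = abs_op T"
    by (rule positive_sqrt_exists[OF abs_op_positive[OF Tb]])
  have hs: "hilbert_schmidt R"
    by (rule positive_trace_class_root[OF R E])
  obtain U where U: "U \<in> bounded_ops" "T = U o\<^sub>L abs_op T"
    by (rule polar_decomposition[OF Tb])
  show ?thesis
  proof (rule that)
    show "hilbert_schmidt (R o\<^sub>L adjoint_op U)" using hs U(1) by (simp add: hilbert_schmidt_compose_right)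
    have eq: "adjoint_op (R o\<^sub>L adjoint_op U) o\<^sub>L R = U o\<^sub>L (R o\<^sub>L R)"
      using U(1) hs by (simp add: adjoint_compose positive_op_adjoint[OF R(1)] compose_assoc)
    show "T = adjoint_op (R o\<^sub>L adjoint_op U) o\<^sub>L R"
      unfolding eq R(2) by (rule U(2))
  qed (rule hs)
qed

text \<open>
  One of the operators \<open>V T\<close> is \<open>\<bar>T\<bar>\<close>. Unlike the definition, this condition is visibly stable under
  sums.
\<close>
lemma trace_class_criterion:
  assumes T: "T \<in> bounded_ops" and E: "onb E"
    and sum: "\<And>V. V \<in> bounded_ops \<Longrightarrow> (\<lambda>e. cinner e (blinfun_apply V (blinfun_apply T e))) summable_on E"
  shows "T \<in> trace_class"
proof -
  obtain V where V: "V \<in> bounded_ops" "abs_op T = V o\<^sub>L T"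
    by (rule abs_op_factorization[OF T])
  have "(\<lambda>e. cinner e (blinfun_apply (abs_op T) e)) summable_on E"
    unfolding V(2) blinfun_apply_blinfun_compose by (rule sum[OF V(1)])
  then show ?thesis using T E unfolding trace_class_def by blast
qed

lemma trace_class_summable:
  assumes T: "T \<in> trace_class" and V: "V \<in> bounded_ops" and E: "onb E"
  shows "(\<lambda>e. cinner e (blinfun_apply V (blinfun_apply T e))) summable_on E"
proof -
  obtain B C where BC: "hilbert_schmidt B" "hilbert_schmidt C" "T = adjoint_op B o\<^sub>L C"
    by (rule trace_class_factor[OF T])
  have BV: "hilbert_schmidt (B o\<^sub>L adjoint_op V)"
    by (rule hilbert_schmidt_compose_right[OF adjoint_op_bounded[OF V] BC(1)])
  have "cinner e (blinfun_apply V (blinfun_apply T e)) = cinner (blinfun_apply (B o\<^sub>L adjoint_op V) e) (blinfun_apply C e)" for e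
    unfolding cinner_adjoint_left[OF V, symmetric] BC(3) blinfun_apply_blinfun_compose
    by (rule cinner_adjoint_right[OF hilbert_schmidt_bounded[OF BC(1)]])
  then show ?thesis
    using hilbert_schmidt_pairing_summable[OF BV BC(2) E] by presburger
qed

lemma trace_class_product:
  assumes B: "hilbert_schmidt B" and C: "hilbert_schmidt C"
  shows "adjoint_op B o\<^sub>L C \<in> trace_class"
proof -
  obtain E :: "'a set" where E: "onb E" using onb_exists by blast
  show ?thesis
  proof (rule trace_class_criterion[OF _ E])
    fix V :: "'a operator" assume V: "V \<in> bounded_ops"
    have BV: "hilbert_schmidt (B o\<^sub>L adjoint_op V)"
      by (rule hilbert_schmidt_compose_right[OF adjoint_op_bounded[OF V] B])
    have "cinner e (blinfun_apply V (blinfun_apply (adjoint_op B o\<^sub>L C) e))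
        = cinner (blinfun_apply (B o\<^sub>L adjoint_op V) e) (blinfun_apply C e)" for e
      unfolding cinner_adjoint_left[OF V, symmetric] blinfun_apply_blinfun_compose
      by (rule cinner_adjoint_right[OF hilbert_schmidt_bounded[OF B]])
    then show "(\<lambda>e. cinner e (blinfun_apply V (blinfun_apply (adjoint_op B o\<^sub>L C) e))) summable_on E"
      using hilbert_schmidt_pairing_summable[OF BV C E] by presburger
  qed (use B C in simp)
qed

lemma trace_class_add:
  assumes S: "S \<in> trace_class" and T: "T \<in> trace_class"
  shows "S + T \<in> trace_class"
proof -
  obtain E :: "'a set" where E: "onb E" using onb_exists by blast
  show ?thesis
    by (rule trace_class_criterion[OF _ E])
      (use S T E in \<open>simp_all add: blinfun.add_left blinfun.add_right cinner_add_right summable_on_add trace_class_summable\<close>)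
qed

lemma trace_class_compose_left:
  assumes A: "A \<in> bounded_ops" and T: "T \<in> trace_class"
  shows "A o\<^sub>L T \<in> trace_class"
proof -
  obtain B C where BC: "hilbert_schmidt B" "hilbert_schmidt C" "T = adjoint_op B o\<^sub>L C"
    by (rule trace_class_factor[OF T])
  have "A o\<^sub>L T = adjoint_op (B o\<^sub>L adjoint_op A) o\<^sub>L C"
    using A BC by (simp add: adjoint_compose compose_assoc)
  then show ?thesis using A BC by (simp add: trace_class_product hilbert_schmidt_compose_right)
qed

lemma trace_class_compose_right:
  assumes A: "A \<in> bounded_ops" and T: "T \<in> trace_class"
  shows "T o\<^sub>L A \<in> trace_class"
proof -
  obtain B C where BC: "hilbert_schmidt B" "hilbert_schmidt C" "T = adjoint_op B o\<^sub>L C"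
    by (rule trace_class_factor[OF T])
  then show ?thesis using A by (simp add: compose_assoc trace_class_product hilbert_schmidt_compose_right)
qed

lemma trace_class_scaleC:
  assumes T: "T \<in> trace_class" shows "c *\<^sub>C T \<in> trace_class"
proof -
  have "c *\<^sub>C T = (c *\<^sub>C id_blinfun) o\<^sub>L T" by (rule blinfun_eqI) simp
  then show ?thesis using T by (simp add: trace_class_compose_left)
qed

lemma has_sum_trace:
  assumes T: "T \<in> trace_class" and E: "onb E"
  shows "((\<lambda>e. cinner e (blinfun_apply T e)) has_sum trace T) E"
proof -
  obtain B C where BC: "hilbert_schmidt B" "hilbert_schmidt C" "T = adjoint_op B o\<^sub>L C"
    by (rule trace_class_factor[OF T])
  have d: "cinner e (blinfun_apply T e) = cinner (blinfun_apply B e) (blinfun_apply C e)" for e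
    using BC(1) by (simp add: BC(3) cinner_adjoint_right)
  have E0: "onb (SOME E :: 'a set. onb E)" using onb_exists by (rule someI_ex)
  have "trace T = (\<Sum>\<^sub>\<infinity>e\<in>E. cinner e (blinfun_apply T e))"
    unfolding trace_def d
    using hilbert_schmidt_pairing_swap[OF BC(1,2) E0 E0] hilbert_schmidt_pairing_swap[OF BC(1,2) E E0] by simp
  then show ?thesis
    using trace_class_summable[OF T bounded_ops_closed(6) E] by simp
qed

lemma trace_eqI:
  assumes "T \<in> trace_class" "onb E" "((\<lambda>e. cinner e (blinfun_apply T e)) has_sum t) E"
  shows "trace T = t"
  using has_sum_trace[OF assms(1,2)] assms(3) has_sum_unique by blast

lemma trace_add:
  assumes S: "S \<in> trace_class" and T: "T \<in> trace_class"
  shows "trace (S + T) = trace S + trace T"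
proof -
  obtain E :: "'a set" where E: "onb E" using onb_exists by blast
  show ?thesis
    by (rule trace_eqI[OF trace_class_add[OF S T] E])
      (use has_sum_add[OF has_sum_trace[OF S E] has_sum_trace[OF T E]] in \<open>simp add: blinfun.add_left cinner_add_right\<close>)
qed

lemma trace_scaleC:
  assumes T: "T \<in> trace_class" shows "trace (c *\<^sub>C T) = c * trace T"
proof -
  obtain E :: "'a set" where E: "onb E" using onb_exists by blast
  show ?thesis
    by (rule trace_eqI[OF trace_class_scaleC[OF T] E])
      (use has_sum_cmult_right[OF has_sum_trace[OF T E], of c] in \<open>simp add: cinner_scaleC_right\<close>)
qed

text \<open>
  Cyclicity for two Hilbert--Schmidt factors is the symmetry of their pairing. Cyclicity for a bounded
  and a trace class operator follows by factoring the latter and absorbing the bounded operator in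
  one of the factors.
\<close>
lemma trace_hilbert_schmidt_commute:
  assumes B: "hilbert_schmidt B" and C: "hilbert_schmidt C"
  shows "trace (adjoint_op B o\<^sub>L C) = trace (C o\<^sub>L adjoint_op B)"
proof -
  obtain E :: "'a set" where E: "onb E" using onb_exists by blast
  have 1: "trace (adjoint_op B o\<^sub>L C) = (\<Sum>\<^sub>\<infinity>e\<in>E. cinner (blinfun_apply B e) (blinfun_apply C e))"
    using infsumI[OF has_sum_trace[OF trace_class_product[OF B C] E]] B by (simp add: cinner_adjoint_right)
  have "C o\<^sub>L adjoint_op B \<in> trace_class"
    using trace_class_product[OF hilbert_schmidt_adjoint[OF C] hilbert_schmidt_adjoint[OF B]] C by simp
  from infsumI[OF has_sum_trace[OF this E]]
  have "trace (C o\<^sub>L adjoint_op B) = (\<Sum>\<^sub>\<infinity>e\<in>E. cinner (blinfun_apply (adjoint_op C) e) (blinfun_apply (adjoint_op B) e))"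
    using C by (simp add: cinner_adjoint_left)
  then show ?thesis using 1 hilbert_schmidt_pairing_swap[OF B C E E] by simp
qed

lemma trace_commute:
  assumes A: "A \<in> bounded_ops" and T: "T \<in> trace_class"
  shows "trace (A o\<^sub>L T) = trace (T o\<^sub>L A)"
proof -
  obtain B C where BC: "hilbert_schmidt B" "hilbert_schmidt C" "T = adjoint_op B o\<^sub>L C"
    by (rule trace_class_factor[OF T])
  have "A o\<^sub>L T = adjoint_op (B o\<^sub>L adjoint_op A) o\<^sub>L C"
    using A BC by (simp add: adjoint_compose compose_assoc)
  then have "trace (A o\<^sub>L T) = trace (C o\<^sub>L adjoint_op (B o\<^sub>L adjoint_op A))"
    using A BC by (simp add: trace_hilbert_schmidt_commute hilbert_schmidt_compose_right)
  also have "\<dots> = trace ((C o\<^sub>L A) o\<^sub>L adjoint_op B)"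
    using A BC by (simp add: adjoint_compose compose_assoc)
  also have "\<dots> = trace (adjoint_op B o\<^sub>L (C o\<^sub>L A))"
    using A BC by (simp add: trace_hilbert_schmidt_commute hilbert_schmidt_compose_right)
  finally show ?thesis by (simp add: BC(3) compose_assoc)
qed

lemma positive_trace_class_square:
  assumes P: "positive_op P" "P \<in> trace_class"
  obtains R where "positive_op R" "hilbert_schmidt R" "P = R o\<^sub>L R"
proof -
  obtain R where R: "positive_op R" "R o\<^sub>L R = P" by (rule positive_sqrt_exists[OF P(1)])
  obtain E where "onb E" "(\<lambda>e. cinner e (blinfun_apply P e)) summable_on E"
    using P(2) abs_op_positive_eq[OF P(1)] unfolding trace_class_def by auto
  then show ?thesis using that R positive_trace_class_root[OF R] by blast
qed

text \<open>
  With \<open>P = R\<^sup>2\<close> cyclicity gives \<open>tr (P S) = tr (R S R) = \<Sum>\<langle>R e, S R e\<rangle>\<close>, and every term is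
  at most \<open>\<parallel>S\<parallel> \<parallel>R e\<parallel>\<^sup>2\<close>.
\<close>
lemma trace_positive_bound:
  assumes P: "positive_op P" "P \<in> trace_class" and S: "S \<in> bounded_ops"
  shows "norm (trace (P o\<^sub>L S)) \<le> norm S * Re (trace P)"
proof -
  obtain E :: "'a set" where E: "onb E" using onb_exists by blast
  obtain R where R: "positive_op R" "hilbert_schmidt R" "P = R o\<^sub>L R"
    by (rule positive_trace_class_square[OF P])
  note adj = positive_op_adjoint[OF R(1)]
  have RS: "hilbert_schmidt (R o\<^sub>L S)" and SR: "hilbert_schmidt (S o\<^sub>L R)"
    using R(2) S by (simp_all add: hilbert_schmidt_compose_left hilbert_schmidt_compose_right)
  have "trace (P o\<^sub>L S) = trace (adjoint_op R o\<^sub>L (R o\<^sub>L S))" by (simp add: R(3) adj compose_assoc)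
  also have "\<dots> = trace (adjoint_op R o\<^sub>L (S o\<^sub>L R))"
    using trace_hilbert_schmidt_commute[OF R(2) RS] by (simp add: adj compose_assoc)
  finally have tr: "((\<lambda>e. cinner (blinfun_apply R e) (blinfun_apply S (blinfun_apply R e))) has_sum trace (P o\<^sub>L S)) E"
    using has_sum_trace[OF trace_class_product[OF R(2) SR] E] R(2) by (simp add: cinner_adjoint_right)
  have "cinner e (blinfun_apply P e) = of_real ((norm (blinfun_apply R e))\<^sup>2)" for e
    unfolding R(3) by (simp add: positive_op_symmetric[OF R(1)] cinner_self)
  then have "((\<lambda>e. (norm (blinfun_apply R e))\<^sup>2) has_sum Re (trace P)) E"
    using has_sum_Re[OF has_sum_trace[OF P(2) E]] by simp
  from tr has_sum_cmult_right[OF this, of "norm S"] show ?thesis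
  proof (rule norm_infsum_le)
    fix e
    show "norm (cinner (blinfun_apply R e) (blinfun_apply S (blinfun_apply R e))) \<le> norm S * (norm (blinfun_apply R e))\<^sup>2"
      using order_trans[OF Cauchy_Schwarz_cinner mult_left_mono[OF norm_blinfun norm_ge_zero],
          of "blinfun_apply R e" S "blinfun_apply R e"]
      by (simp add: power2_eq_square mult.left_commute)
  qed
qed

section \<open>Rank-one operators\<close>

text \<open>In bra-ket notation this is \<open>|x\<rangle>\<langle>y|\<close>.\<close>
definition rank_one :: "'h::chilbert_space \<Rightarrow> 'h \<Rightarrow> 'h operator"
  where "rank_one x y = Blinfun (\<lambda>z. cinner y z *\<^sub>C x)"

lemma rank_one_apply [simp]: "blinfun_apply (rank_one x y) z = cinner y z *\<^sub>C x"
proof -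
  have "bounded_linear (\<lambda>z. cinner y z *\<^sub>C x)"
  proof (rule bounded_linear_intro[where K = "norm y * norm x"])
    show "norm (cinner y z *\<^sub>C x) \<le> norm z * (norm y * norm x)" for z
      using mult_right_mono[OF Cauchy_Schwarz_cinner[of y z] norm_ge_zero[of x]]
      by (simp add: norm_scaleC ac_simps)
  qed (simp_all add: cinner_add_right scaleC_add_left scaleR_scaleC cinner_scaleC_right scaleC_scaleC)
  then show ?thesis by (simp add: rank_one_def bounded_linear_Blinfun_apply)
qed

lemma rank_one_bounded [simp, intro]: "rank_one x y \<in> bounded_ops"
  by (simp add: bounded_ops_def cinner_scaleC_right scaleC_scaleC)

lemma rank_one_add_left: "rank_one (x + x') y = rank_one x y + rank_one x' y"
  and rank_one_add_right: "rank_one x (y + y') = rank_one x y + rank_one x y'"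
  and rank_one_scaleC_left: "rank_one (c *\<^sub>C x) y = c *\<^sub>C rank_one x y"
  and rank_one_scaleC_right: "rank_one x (c *\<^sub>C y) = cnj c *\<^sub>C rank_one x y"
  by (rule blinfun_eqI; simp add: blinfun.add_left scaleC_add_right scaleC_add_left cinner_simps
      scaleC_scaleC mult.commute)+

lemma compose_rank_one: "A \<in> bounded_ops \<Longrightarrow> A o\<^sub>L rank_one x y = rank_one (blinfun_apply A x) y"
  by (rule blinfun_eqI) (simp add: bounded_opsD)

lemma adjoint_rank_one: "adjoint_op (rank_one x y) = rank_one y x"
  by (rule adjoint_op_eqI) (simp_all add: cinner_scaleC_left cinner_scaleC_right mult.commute flip: cinner_commute)

lemma positive_rank_one: "positive_op (rank_one x x)"
proof -
  have "cinner z (blinfun_apply (rank_one x x) z) = of_real ((norm (cinner x z))\<^sup>2)" for z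
    by (metis cinner_commute cinner_scaleC_right complex_norm_square rank_one_apply)
  then show ?thesis by (simp add: positive_op_def)
qed

lemma hilbert_schmidt_rank_one: "hilbert_schmidt (rank_one x y)"
proof -
  obtain E :: "'a set" where E: "onb E" using onb_exists by blast
  have "(norm (blinfun_apply (rank_one x y) e))\<^sup>2 = (norm x)\<^sup>2 * (norm (cinner e y))\<^sup>2" for e
    by (simp add: norm_scaleC power_mult_distrib) (metis cinner_commute complex_mod_cnj)
  moreover have "(\<lambda>e. (norm x)\<^sup>2 * (norm (cinner e y))\<^sup>2) summable_on E"
    using parseval_norm[OF E, of y] by (intro summable_on_cmult_right) (rule has_sum_imp_summable)
  ultimately show ?thesis using E unfolding hilbert_schmidt_def by auto
qed

lemma rank_one_trace_class [simp, intro]: "rank_one x y \<in> trace_class"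
proof -
  \<comment> \<open>for \<open>x = 0\<close> both sides vanish, as \<open>1 / 0 = 0\<close>\<close>
  have "rank_one x y = adjoint_op (rank_one x x) o\<^sub>L (of_real (1 / (norm x)\<^sup>2) *\<^sub>C rank_one x y)"
    by (rule blinfun_eqI)
      (simp add: adjoint_rank_one cinner_scaleC_right cinner_self scaleC_scaleC)
  moreover have "adjoint_op (rank_one x x) o\<^sub>L (of_real (1 / (norm x)\<^sup>2) *\<^sub>C rank_one x y) \<in> trace_class"
    by (intro trace_class_product hilbert_schmidt_scaleC hilbert_schmidt_rank_one)
  ultimately show ?thesis by simp
qed

lemma trace_rank_one: "trace (rank_one x y) = cinner y x"
proof -
  obtain E :: "'a set" where E: "onb E" using onb_exists by blast
  show ?thesis
    by (rule trace_eqI[OF rank_one_trace_class E])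
      (use parseval[OF E, of y x] in \<open>simp add: cinner_scaleC_right\<close>)
qed

lemma trace_rank_one_compose:
  "R \<in> bounded_ops \<Longrightarrow> trace (rank_one x y o\<^sub>L R) = cinner y (blinfun_apply R x)"
  by (simp add: compose_rank_one trace_rank_one flip: trace_commute)

lemma trace_pairing_nondegenerate:
  assumes "R \<in> bounded_ops" "R' \<in> bounded_ops"
    and "\<And>T. T \<in> trace_class \<Longrightarrow> trace (T o\<^sub>L R) = trace (T o\<^sub>L R')"
  shows "R = R'"
  by (rule op_eqI) (metis assms rank_one_trace_class trace_rank_one_compose)

lemma trace_pairing_nondegenerate_left:
  assumes T: "T \<in> trace_class" and T': "T' \<in> trace_class"
    and eq: "\<And>S. S \<in> bounded_ops \<Longrightarrow> trace (T o\<^sub>L S) = trace (T' o\<^sub>L S)"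
  shows "T = T'"
proof (rule op_eqI)
  fix x y :: 'a
  have "cinner x (blinfun_apply U y) = trace (U o\<^sub>L rank_one y x)" if "U \<in> trace_class" for U
    using that by (simp add: compose_rank_one trace_rank_one trace_class_bounded)
  then show "cinner x (blinfun_apply T y) = cinner x (blinfun_apply T' y)"
    using eq[OF rank_one_bounded, of y x] T T' by simp
qed

section \<open>Reduction of trace class operators to rank-one operators\<close>

lemma trace_class_zero [simp]: "0 \<in> trace_class"
proof -
  have "0 = rank_one 0 (0 :: 'a)" by (rule blinfun_eqI) simp
  then show ?thesis by (metis rank_one_trace_class)
qed

lemma trace_class_sum:
  "(\<And>i. i \<in> F \<Longrightarrow> T i \<in> trace_class) \<Longrightarrow> sum T F \<in> trace_class"
  by (induction F rule: infinite_finite_induct) (simp_all add: trace_class_add)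

text \<open>
  The trace class is spanned by squares \<open>X\<^sup>* X\<close> of Hilbert--Schmidt operators: polarize the product
  \<open>B\<^sup>* C\<close> of \<open>trace_class_factor\<close>.
\<close>
lemma trace_class_induct [consumes 1, case_names square add scaleC]:
  fixes T :: "'h::chilbert_space operator"
  assumes T: "T \<in> trace_class"
    and square: "\<And>X. hilbert_schmidt X \<Longrightarrow> P (adjoint_op X o\<^sub>L X)"
    and add: "\<And>S T. S \<in> trace_class \<Longrightarrow> T \<in> trace_class \<Longrightarrow> P S \<Longrightarrow> P T \<Longrightarrow> P (S + T)"
    and scaleC: "\<And>c T. T \<in> trace_class \<Longrightarrow> P T \<Longrightarrow> P (c *\<^sub>C T)"
  shows "P T"
proof -
  obtain B C where BC: "hilbert_schmidt B" "hilbert_schmidt C" "T = adjoint_op B o\<^sub>L C"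
    by (rule trace_class_factor[OF T])
  define Q where "Q c = adjoint_op (B + c *\<^sub>C C) o\<^sub>L (B + c *\<^sub>C C)" for c
  have hs: "hilbert_schmidt (B + c *\<^sub>C C)" for c
    by (intro hilbert_schmidt_add hilbert_schmidt_scaleC BC)
  have Q: "Q c \<in> trace_class" "P (Q c)" for c
    unfolding Q_def using hs by (auto intro: trace_class_product square)
  have "T = (1/4) *\<^sub>C (Q 1 + (- 1) *\<^sub>C Q (- 1) + (- \<i>) *\<^sub>C Q \<i> + \<i> *\<^sub>C Q (- \<i>))"
  proof (rule op_eqI)
    fix x y
    have q: "cinner x (blinfun_apply (Q c) y)
      = cinner (blinfun_apply B x) (blinfun_apply B y) + c * cinner (blinfun_apply B x) (blinfun_apply C y)
        + cnj c * cinner (blinfun_apply C x) (blinfun_apply B y) + cnj c * c * cinner (blinfun_apply C x) (blinfun_apply C y)" for c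
      using hs[of c] by (simp add: Q_def cinner_adjoint_right blinfun.add_left cinner_simps algebra_simps)
    show "cinner x (blinfun_apply T y) = cinner x (blinfun_apply ((1/4) *\<^sub>C (Q 1 + (- 1) *\<^sub>C Q (- 1) + (- \<i>) *\<^sub>C Q \<i> + \<i> *\<^sub>C Q (- \<i>))) y)"
      using BC(1) by (simp add: BC(3) cinner_adjoint_right blinfun.add_left cinner_add_right cinner_scaleC_right q algebra_simps)
  qed
  moreover have "P ((1/4) *\<^sub>C (Q 1 + (- 1) *\<^sub>C Q (- 1) + (- \<i>) *\<^sub>C Q \<i> + \<i> *\<^sub>C Q (- \<i>)))"
    by (intro scaleC add trace_class_add trace_class_scaleC Q)
  ultimately show ?thesis by simp
qed

text \<open>
  \<open>T\<^sub>F\<close> is \<open>X\<^sup>* P\<^sub>F X\<close> for the projection \<open>P\<^sub>F\<close> onto the span of \<open>F\<close>, so the quadratic form of the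
  difference is the defect in Bessel's inequality for \<open>X x\<close>. This replaces the spectral decomposition
  of a compact operator.
\<close>
lemma square_finite_rank_approximation:
  assumes X: "hilbert_schmidt X" and E: "onb E" and F: "finite F" "F \<subseteq> E"
  defines "T\<^sub>F \<equiv> \<Sum>e\<in>F. rank_one (blinfun_apply (adjoint_op X) e) (blinfun_apply (adjoint_op X) e)"
  shows "positive_op ((adjoint_op X o\<^sub>L X) - T\<^sub>F)"
proof (rule positive_opI)
  have ap: "blinfun_apply T\<^sub>F z = (\<Sum>e\<in>F. cinner e (blinfun_apply X z) *\<^sub>C blinfun_apply (adjoint_op X) e)" for z
    unfolding T\<^sub>F_def blinfun.sum_left using X by (simp add: cinner_adjoint_left)
  have TFb: "T\<^sub>F \<in> bounded_ops"
    unfolding T\<^sub>F_def by (intro trace_class_bounded trace_class_sum rank_one_trace_class)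
  then show "(adjoint_op X o\<^sub>L X) - T\<^sub>F \<in> bounded_ops" using X by simp
  note adj = cinner_adjoint_right[OF hilbert_schmidt_bounded[OF X]] cinner_adjoint_left[OF hilbert_schmidt_bounded[OF X]]
  show "cinner x (blinfun_apply ((adjoint_op X o\<^sub>L X) - T\<^sub>F) y) = cinner (blinfun_apply ((adjoint_op X o\<^sub>L X) - T\<^sub>F) x) y" for x y
  proof -
    have "cinner x (blinfun_apply T\<^sub>F y) = cinner (blinfun_apply T\<^sub>F x) y"
      unfolding T\<^sub>F_def blinfun.sum_left cinner_sum_left cinner_sum_right
      by (intro sum.cong refl positive_op_symmetric positive_rank_one)
    moreover have "cinner x (blinfun_apply (adjoint_op X o\<^sub>L X) y) = cinner (blinfun_apply (adjoint_op X o\<^sub>L X) x) y"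
      by (intro positive_op_symmetric positive_op_square hilbert_schmidt_bounded X)
    ultimately show ?thesis
      unfolding blinfun.diff_left cinner_diff_left cinner_diff_right by (rule arg_cong2[where f = minus, rotated])
  qed
  fix x
  let ?z = "blinfun_apply X x"
  have "cinner x (blinfun_apply T\<^sub>F x) = (\<Sum>e\<in>F. of_real ((norm (cinner e ?z))\<^sup>2))"
    unfolding ap cinner_sum_right cinner_scaleC_right adj
    by (intro sum.cong refl) (metis cinner_commute complex_norm_square)
  then have "Re (cinner x (blinfun_apply ((adjoint_op X o\<^sub>L X) - T\<^sub>F) x)) = (norm ?z)\<^sup>2 - (\<Sum>e\<in>F. (norm (cinner e ?z))\<^sup>2)"
    by (simp add: blinfun.diff_left cinner_diff_right adj cinner_self_Re)
  also have "\<dots> \<ge> 0" using norm_onb_projection[OF E F, of ?z] by (smt (verit) zero_le_power2)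
  finally show "0 \<le> Re (cinner x (blinfun_apply ((adjoint_op X o\<^sub>L X) - T\<^sub>F) x))" .
qed

lemma trace_square:
  assumes X: "hilbert_schmidt X" and E: "onb E"
  shows "((\<lambda>e. (norm (blinfun_apply (adjoint_op X) e))\<^sup>2) has_sum Re (trace (adjoint_op X o\<^sub>L X))) E"
proof -
  have "X o\<^sub>L adjoint_op X \<in> trace_class"
    using trace_class_product[OF hilbert_schmidt_adjoint[OF X] hilbert_schmidt_adjoint[OF X]] X by simp
  from has_sum_Re[OF has_sum_trace[OF this E]]
  have "((\<lambda>e. Re (cinner e (blinfun_apply X (blinfun_apply (adjoint_op X) e)))) has_sum Re (trace (adjoint_op X o\<^sub>L X))) E"
    by (simp add: trace_hilbert_schmidt_commute[OF X X])
  then show ?thesis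
    unfolding cinner_adjoint_left[OF hilbert_schmidt_bounded[OF X], symmetric] cinner_self_Re .
qed

text \<open>
  A functional dominated by the trace on positive operators is continuous enough to be determined by
  its values on rank-one operators: its value on \<open>X\<^sup>* X\<close> does not change when the finite-rank
  approximation is subtracted, and the trace of the positive remainder tends to zero.
\<close>
lemma trace_class_functional_zero:
  fixes \<phi> :: "'h::chilbert_space operator \<Rightarrow> complex"
  assumes add: "\<And>S T. S \<in> trace_class \<Longrightarrow> T \<in> trace_class \<Longrightarrow> \<phi> (S + T) = \<phi> S + \<phi> T"
    and scaleC: "\<And>c T. T \<in> trace_class \<Longrightarrow> \<phi> (c *\<^sub>C T) = c * \<phi> T"
    and bound: "\<And>T. T \<in> trace_class \<Longrightarrow> positive_op T \<Longrightarrow> norm (\<phi> T) \<le> K * Re (trace T)"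
    and zero: "\<And>x. \<phi> (rank_one x x) = 0"
    and T: "T \<in> trace_class"
  shows "\<phi> T = 0"
  using T
proof (induction T rule: trace_class_induct)
  case (square X)
  obtain E :: "'h set" where E: "onb E" using onb_exists by blast
  let ?T = "adjoint_op X o\<^sub>L X" and ?s = "\<lambda>F. \<Sum>e\<in>F. (norm (blinfun_apply (adjoint_op X) e))\<^sup>2"
  let ?TF = "\<lambda>F. \<Sum>e\<in>F. rank_one (blinfun_apply (adjoint_op X) e) (blinfun_apply (adjoint_op X) e)"
  have T: "?T \<in> trace_class" by (rule trace_class_product[OF square square])
  have TF: "?TF F \<in> trace_class" for F by (intro trace_class_sum rank_one_trace_class)
  have zero0: "\<phi> 0 = 0" "trace (0 :: 'h operator) = 0"
    using scaleC[of 0 0] trace_scaleC[of "0 :: 'h operator" 0] by simp_all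
  have \<phi>F: "\<phi> (?TF F) = 0" and trF: "trace (?TF F) = of_real (?s F)" if "finite F" for F
    using that by (induction F) (simp_all add: zero0 add trace_add TF zero trace_rank_one cinner_self)
  have le: "norm (\<phi> ?T) \<le> K * (Re (trace ?T) - ?s F)" if F: "finite F" "F \<subseteq> E" for F
  proof -
    have DF: "?T - ?TF F \<in> trace_class"
      using trace_class_add[OF T trace_class_scaleC[OF TF[of F], of "- 1"]]
      by (simp add: scaleC_minus_one)
    have "\<phi> ?T = \<phi> (?T - ?TF F)" using add[OF DF TF[of F]] F by (simp add: \<phi>F)
    moreover have "trace ?T = trace (?T - ?TF F) + of_real (?s F)"
      using trace_add[OF DF TF[of F]] F by (simp add: trF)
    ultimately show ?thesis
      using bound[OF DF square_finite_rank_approximation[OF square E F]] by simp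
  qed
  have "(?s \<longlongrightarrow> Re (trace ?T)) (finite_subsets_at_top E)"
    using trace_square[OF square E] by (simp add: has_sum_def)
  then have "((\<lambda>F. K * (Re (trace ?T) - ?s F)) \<longlongrightarrow> K * (Re (trace ?T) - Re (trace ?T))) (finite_subsets_at_top E)"
    by (intro tendsto_intros)
  then have "norm (\<phi> ?T) \<le> K * (Re (trace ?T) - Re (trace ?T))"
    by (rule tendsto_lowerbound) (auto intro!: eventually_finite_subsets_at_top_weakI le)
  then show ?case by simp
qed (simp_all add: add scaleC)

text \<open>
  Polarization and the parallelogram law bound \<open>b y x\<close> by \<open>K (\<parallel>y\<parallel>\<^sup>2 + \<parallel>x\<parallel>\<^sup>2)\<close>; normalizing both vectors
  turns this into a bound by the product of the norms.
\<close>
lemma sesquilinear_form_bounded: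
  fixes b :: "'h::chilbert_space \<Rightarrow> 'h \<Rightarrow> complex"
  assumes add_right: "\<And>y x x'. b y (x + x') = b y x + b y x'"
    and scale_right: "\<And>c y x. b y (c *\<^sub>C x) = c * b y x"
    and add_left: "\<And>y y' x. b (y + y') x = b y x + b y' x"
    and scale_left: "\<And>c y x. b (c *\<^sub>C y) x = cnj c * b y x"
    and diag: "\<And>x. norm (b x x) \<le> K * (norm x)\<^sup>2"
  shows "norm (b y x) \<le> 2 * K * (norm y * norm x)"
proof -
  have polar: "4 * b y x = b (y + x) (y + x) - b (y + (- 1) *\<^sub>C x) (y + (- 1) *\<^sub>C x)
      - \<i> * b (y + \<i> *\<^sub>C x) (y + \<i> *\<^sub>C x) + \<i> * b (y + (- \<i>) *\<^sub>C x) (y + (- \<i>) *\<^sub>C x)" for y x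
    by (simp add: add_right add_left scale_right scale_left algebra_simps)
  have par: "(norm (y + c *\<^sub>C x))\<^sup>2 + (norm (y + (- c) *\<^sub>C x))\<^sup>2 = 2 * ((norm y)\<^sup>2 + (norm x)\<^sup>2)" if "norm c = 1" for c y and x :: 'h
  proof -
    have "(- c) *\<^sub>C x = - (c *\<^sub>C x)" by (metis minus_mult_minus mult_1 scaleC_minus_one scaleC_scaleC mult_minus1)
    moreover have "norm (c *\<^sub>C x) = norm x" using that by (simp add: norm_scaleC)
    moreover have "(norm (y + u))\<^sup>2 + (norm (y - u))\<^sup>2 = 2 * ((norm y)\<^sup>2 + (norm u)\<^sup>2)" for u
      by (simp add: power2_norm_eq_inner algebra_simps)
    ultimately show ?thesis by simp
  qed
  have sym: "norm (b y x) \<le> K * ((norm y)\<^sup>2 + (norm x)\<^sup>2)" for y x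
  proof -
    have "4 * norm (b y x) = norm (4 * b y x)" by (simp add: norm_mult)
    also have "\<dots> \<le> norm (b (y + 1 *\<^sub>C x) (y + 1 *\<^sub>C x)) + norm (b (y + (- 1) *\<^sub>C x) (y + (- 1) *\<^sub>C x))
      + norm (b (y + \<i> *\<^sub>C x) (y + \<i> *\<^sub>C x)) + norm (b (y + (- \<i>) *\<^sub>C x) (y + (- \<i>) *\<^sub>C x))"
      unfolding polar scaleC_one
      by (intro order_trans[OF norm_triangle_ineq] order_trans[OF norm_triangle_ineq4] add_mono) (simp_all add: norm_mult)
    also have "\<dots> \<le> K * (norm (y + 1 *\<^sub>C x))\<^sup>2 + K * (norm (y + (- 1) *\<^sub>C x))\<^sup>2
      + K * (norm (y + \<i> *\<^sub>C x))\<^sup>2 + K * (norm (y + (- \<i>) *\<^sub>C x))\<^sup>2"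
      by (intro add_mono diag)
    also have "\<dots> = K * ((norm (y + 1 *\<^sub>C x))\<^sup>2 + (norm (y + (- 1) *\<^sub>C x))\<^sup>2)
      + K * ((norm (y + \<i> *\<^sub>C x))\<^sup>2 + (norm (y + (- \<i>) *\<^sub>C x))\<^sup>2)" by (simp add: algebra_simps)
    also have "\<dots> = 4 * (K * ((norm y)\<^sup>2 + (norm x)\<^sup>2))" unfolding par[OF norm_one] par[OF norm_ii] by simp
    finally show ?thesis by simp
  qed
  have b0: "b 0 x = 0" "b y 0 = 0" for x y
    using scale_left[of 0 0 x] scale_right[of y 0 0] by simp_all
  show ?thesis
  proof (cases "x = 0 \<or> y = 0")
    case False
    let ?u = "of_real (1 / norm y) *\<^sub>C y" and ?v = "of_real (1 / norm x) *\<^sub>C x"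
    have n: "norm ?u = 1" "norm ?v = 1" using False by (simp_all add: norm_scaleC norm_divide)
    have "y = of_real (norm y) *\<^sub>C ?u" "x = of_real (norm x) *\<^sub>C ?v"
      using False by (simp_all add: scaleC_scaleC)
    then have "b y x = of_real (norm y) * of_real (norm x) * b ?u ?v"
      by (metis (no_types, lifting) complex_cnj_complex_of_real mult.assoc scale_left scale_right)
    then have "norm (b y x) = norm y * norm x * norm (b ?u ?v)" by (simp add: norm_mult)
    also have "\<dots> \<le> norm y * norm x * (K * (1\<^sup>2 + 1\<^sup>2))"
      using sym[of ?u ?v] unfolding n by (intro mult_left_mono) auto
    finally show ?thesis by (simp add: ac_simps)
  qed (auto simp: b0)
qed

section \<open>The dual of a quantum operation\<close>

lemma quantum_operationD:
  assumes "quantum_operation \<Psi>"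
  shows quantum_operation_trace_class: "T \<in> trace_class \<Longrightarrow> \<Psi> T \<in> trace_class"
    and quantum_operation_add: "S \<in> trace_class \<Longrightarrow> T \<in> trace_class \<Longrightarrow> \<Psi> (S + T) = \<Psi> S + \<Psi> T"
    and quantum_operation_scaleC: "T \<in> trace_class \<Longrightarrow> \<Psi> (c *\<^sub>C T) = c *\<^sub>C \<Psi> T"
    and quantum_operation_cp: "completely_positive \<Psi>"
    and quantum_operation_trace: "T \<in> trace_class \<Longrightarrow> trace (\<Psi> T) = trace T"
  using assms unfolding quantum_operation_def by blast+

lemma completely_positiveD:
  assumes "completely_positive \<Psi>" "positive_matrix n T" "\<And>i j. T i j \<in> trace_class"
  shows "positive_matrix n (\<lambda>i j. \<Psi> (T i j))"
  using assms by (simp add: completely_positive_def)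

lemma quantum_operation_positive:
  assumes \<Psi>: "quantum_operation \<Psi>" and T: "T \<in> trace_class" "positive_op T"
  shows "positive_op (\<Psi> T)"
proof -
  have "positive_matrix (Suc 0) (\<lambda>i j. T)"
    using T(2) by (simp add: positive_matrix_def positive_op_def)
  then have "positive_matrix (Suc 0) (\<lambda>i j. \<Psi> T)"
    by (rule completely_positiveD[OF quantum_operation_cp[OF \<Psi>]]) (rule T(1))
  then have "cinner x (blinfun_apply (\<Psi> T) x) \<in> \<real>\<^sub>\<ge>\<^sub>0" for x
    unfolding positive_matrix_def by (elim allE[of _ "\<lambda>_. x"]) simp
  then show ?thesis
    using quantum_operation_trace_class[OF \<Psi> T(1)] by (simp add: positive_op_def trace_class_bounded)
qed

lemma trace_pairing_add:
  assumes "S \<in> bounded_ops" "T \<in> trace_class" "U \<in> trace_class"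
  shows "trace ((T + U) o\<^sub>L S) = trace (T o\<^sub>L S) + trace (U o\<^sub>L S)"
  using assms by (simp add: compose_distribs trace_add trace_class_compose_right)

lemma trace_pairing_scaleC:
  assumes "S \<in> bounded_ops" "T \<in> trace_class"
  shows "trace ((c *\<^sub>C T) o\<^sub>L S) = c * trace (T o\<^sub>L S)"
proof -
  have "(c *\<^sub>C T) o\<^sub>L S = c *\<^sub>C (T o\<^sub>L S)" by (rule blinfun_eqI) simp
  then show ?thesis using assms by (simp add: trace_scaleC trace_class_compose_right)
qed

text \<open>
  The functional \<open>f T = tr (\<Psi>(T) S)\<close> is dominated by the trace since \<open>\<Psi>\<close> preserves positivity and
  trace. This bounds the form \<open>f (|x\<rangle>\<langle>y|)\<close>, whose representing operator is \<open>R\<close>, and it also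
  forces \<open>f\<close> to agree with the pairing with \<open>R\<close> beyond rank one.
\<close>
lemma dual_map_exists:
  assumes \<Psi>: "quantum_operation (\<Psi> :: 'h::chilbert_space operator \<Rightarrow> 'h operator)" and S: "S \<in> bounded_ops"
  obtains R where "R \<in> bounded_ops" "\<And>T. T \<in> trace_class \<Longrightarrow> trace (\<Psi> T o\<^sub>L S) = trace (T o\<^sub>L R)"
proof -
  note tc = quantum_operation_trace_class[OF \<Psi>]
  define f where "f T = trace (\<Psi> T o\<^sub>L S)" for T
  have f_add: "f (T + U) = f T + f U" if "T \<in> trace_class" "U \<in> trace_class" for T U
    using that by (simp add: f_def quantum_operation_add[OF \<Psi>] trace_pairing_add tc S)
  have f_scale: "f (c *\<^sub>C T) = c * f T" if "T \<in> trace_class" for c T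
    using that by (simp add: f_def quantum_operation_scaleC[OF \<Psi>] trace_pairing_scaleC tc S)
  have f_bound: "norm (f T) \<le> norm S * Re (trace T)" if "T \<in> trace_class" "positive_op T" for T
    using trace_positive_bound[OF quantum_operation_positive[OF \<Psi> that] tc[OF that(1)] S]
    by (simp add: f_def quantum_operation_trace[OF \<Psi> that(1)])
  define b where "b y x = f (rank_one x y)" for y x
  have b: "b y (x + x') = b y x + b y x'" "b y (c *\<^sub>C x) = c * b y x"
    "b (y + y') x = b y x + b y' x" "b (c *\<^sub>C y) x = cnj c * b y x" for c x x' y y'
    by (simp_all add: b_def rank_one_add_left rank_one_add_right rank_one_scaleC_left rank_one_scaleC_right f_add f_scale)
  have diag: "norm (b x x) \<le> norm S * (norm x)\<^sup>2" for x
    using f_bound[OF rank_one_trace_class positive_rank_one, of x]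
    by (simp add: b_def trace_rank_one cinner_self_Re)
  obtain R where R: "R \<in> bounded_ops" "\<And>y x. cinner y (blinfun_apply R x) = b y x"
    by (rule sesquilinear_form_representation[where b = b, OF b(1,2,3,4) sesquilinear_form_bounded[where b = b, OF b(1,2,3,4) diag]])
      auto
  have "f T - trace (T o\<^sub>L R) = 0" if "T \<in> trace_class" for T
  proof (rule trace_class_functional_zero[where \<phi> = "\<lambda>T. f T - trace (T o\<^sub>L R)" and K = "norm S + norm R", OF _ _ _ _ that])
    fix T U :: "'h operator" and c assume T: "T \<in> trace_class"
    show "f (c *\<^sub>C T) - trace (c *\<^sub>C T o\<^sub>L R) = c * (f T - trace (T o\<^sub>L R))"
      using T by (simp add: f_scale trace_pairing_scaleC tc R(1) right_diff_distrib)
    show "f (T + U) - trace (T + U o\<^sub>L R) = f T - trace (T o\<^sub>L R) + (f U - trace (U o\<^sub>L R))" if "U \<in> trace_class"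
      using T that by (simp add: f_add trace_pairing_add tc R(1))
    show "norm (f T - trace (T o\<^sub>L R)) \<le> (norm S + norm R) * Re (trace T)" if "positive_op T"
      using norm_triangle_ineq4[of "f T" "trace (T o\<^sub>L R)"] f_bound[OF T that] trace_positive_bound[OF that T R(1)]
      by (simp add: distrib_right)
  next
    show "f (rank_one x x) - trace (rank_one x x o\<^sub>L R) = 0" for x
      using R by (simp add: trace_rank_one_compose b_def)
  qed
  then show ?thesis using that R(1) by (simp add: f_def)
qed

lemma dual_map:
  assumes \<Psi>: "quantum_operation \<Psi>" and S: "S \<in> bounded_ops"
  shows dual_map_bounded: "dual_map \<Psi> S \<in> bounded_ops"
    and trace_dual_map: "T \<in> trace_class \<Longrightarrow> trace (\<Psi> T o\<^sub>L S) = trace (T o\<^sub>L dual_map \<Psi> S)"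
proof -
  obtain R where R: "R \<in> bounded_ops" "\<And>T. T \<in> trace_class \<Longrightarrow> trace (\<Psi> T o\<^sub>L S) = trace (T o\<^sub>L R)"
    by (rule dual_map_exists[OF \<Psi> S]) blast
  have "dual_map \<Psi> S \<in> bounded_ops \<and> (\<forall>T\<in>trace_class. trace (\<Psi> T o\<^sub>L S) = trace (T o\<^sub>L dual_map \<Psi> S))"
    unfolding dual_map_def
  proof (rule theI[of _ R])
    fix R' assume R': "R' \<in> bounded_ops \<and> (\<forall>T\<in>trace_class. trace (\<Psi> T o\<^sub>L S) = trace (T o\<^sub>L R'))"
    show "R' = R"
      by (rule trace_pairing_nondegenerate) (use R R' in auto)
  qed (use R in blast)
  then show "dual_map \<Psi> S \<in> bounded_ops"
    "T \<in> trace_class \<Longrightarrow> trace (\<Psi> T o\<^sub>L S) = trace (T o\<^sub>L dual_map \<Psi> S)" by blast+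
qed

lemma dual_map_eqI:
  assumes \<Psi>: "quantum_operation \<Psi>" and S: "S \<in> bounded_ops" and R: "R \<in> bounded_ops"
    and eq: "\<And>T. T \<in> trace_class \<Longrightarrow> trace (\<Psi> T o\<^sub>L S) = trace (T o\<^sub>L R)"
  shows "dual_map \<Psi> S = R"
  by (rule trace_pairing_nondegenerate) (use assms trace_dual_map[OF \<Psi> S] in \<open>simp_all add: dual_map_bounded\<close>)

lemma compose_id [simp]: "A o\<^sub>L id_blinfun = A" "id_blinfun o\<^sub>L A = A"
  by (rule blinfun_eqI; simp)+

lemma dual_map_id:
  assumes \<Psi>: "quantum_operation \<Psi>" shows "dual_map \<Psi> id_blinfun = id_blinfun"
  by (rule dual_map_eqI[OF \<Psi>]) (simp_all add: quantum_operation_trace[OF \<Psi>])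

lemma cinner_dual_map:
  assumes \<Psi>: "quantum_operation \<Psi>" and S: "S \<in> bounded_ops"
  shows "cinner x (blinfun_apply (dual_map \<Psi> S) y) = trace (\<Psi> (rank_one y x) o\<^sub>L S)"
  by (simp add: trace_dual_map[OF \<Psi> S] trace_rank_one_compose dual_map_bounded[OF \<Psi> S])

lemma has_sum_sum:
  fixes f :: "'i \<Rightarrow> 'a \<Rightarrow> 'b :: topological_comm_monoid_add"
  shows "finite I \<Longrightarrow> (\<And>i. i \<in> I \<Longrightarrow> (f i has_sum s i) A) \<Longrightarrow> ((\<lambda>x. \<Sum>i\<in>I. f i x) has_sum (\<Sum>i\<in>I. s i)) A"
  by (induction I rule: finite_induct) (auto intro: has_sum_add)

lemma has_sum_nonneg_Reals:
  fixes f :: "'a \<Rightarrow> complex"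
  assumes f: "(f has_sum s) A" and nonneg: "\<And>x. x \<in> A \<Longrightarrow> f x \<in> \<real>\<^sub>\<ge>\<^sub>0"
  shows "s \<in> \<real>\<^sub>\<ge>\<^sub>0"
proof -
  have "0 \<le> Re s"
    by (rule has_sum_nonneg[OF has_sum_Re[OF f]]) (use nonneg in \<open>simp add: complex_nonneg_Reals_iff\<close>)
  moreover have "((\<lambda>x. 0) has_sum Im s) A"
    using has_sum_Im[OF f] nonneg by (subst has_sum_cong[where g = "\<lambda>x. Im (f x)"]) (auto simp: complex_nonneg_Reals_iff)
  then have "Im s = 0" using has_sum_unique[OF _ has_sum_0_simp] by metis
  ultimately show ?thesis by (simp add: complex_nonneg_Reals_iff)
qed

text \<open>
  By cyclicity each entry is the sum over a Hilbert basis of \<open>\<langle>X\<^sub>j\<^sup>* e, \<Psi>(|x\<^sub>j\<rangle>\<langle>x\<^sub>i|) X\<^sub>i\<^sup>* e\<rangle>\<close>. For each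
  \<open>e\<close>, summing over \<open>i\<close> and \<open>j\<close> evaluates at the vectors \<open>X\<^sub>i\<^sup>* e\<close> the image under \<open>\<Psi>\<close> of the positive matrix
  with entries \<open>|x\<^sub>j\<rangle>\<langle>x\<^sub>i|\<close>, with \<open>j\<close> as the row index.
\<close>
lemma dual_map_completely_positive:
  fixes x :: "nat \<Rightarrow> 'h::chilbert_space"
  assumes \<Psi>: "quantum_operation \<Psi>"
    and X: "\<And>i. i < n \<Longrightarrow> X i \<in> bounded_ops"
  shows "(\<Sum>i<n. \<Sum>j<n. cinner (x i) (blinfun_apply (dual_map \<Psi> (adjoint_op (X i) o\<^sub>L X j)) (x j))) \<in> \<real>\<^sub>\<ge>\<^sub>0"
proof -
  obtain E :: "'h set" where E: "onb E" using onb_exists by blast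
  let ?r = "\<lambda>i j. rank_one (x i) (x j)"
  have \<Psi>r: "\<Psi> (?r i j) \<in> trace_class" for i j
    by (rule quantum_operation_trace_class[OF \<Psi> rank_one_trace_class])
  have s: "((\<lambda>e. cinner (blinfun_apply (adjoint_op (X j)) e) (blinfun_apply (\<Psi> (?r j i)) (blinfun_apply (adjoint_op (X i)) e)))
      has_sum cinner (x i) (blinfun_apply (dual_map \<Psi> (adjoint_op (X i) o\<^sub>L X j)) (x j))) E"
    if "i < n" "j < n" for i j
  proof -
    note Xi = X[OF that(1)] and Xj = X[OF that(2)]
    have tc: "\<Psi> (?r j i) o\<^sub>L adjoint_op (X i) \<in> trace_class"
      by (rule trace_class_compose_right[OF adjoint_op_bounded[OF Xi] \<Psi>r])
    have "cinner (x i) (blinfun_apply (dual_map \<Psi> (adjoint_op (X i) o\<^sub>L X j)) (x j))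
        = trace ((\<Psi> (?r j i) o\<^sub>L adjoint_op (X i)) o\<^sub>L X j)"
      using Xi Xj by (simp add: cinner_dual_map[OF \<Psi>] compose_assoc)
    also have "\<dots> = trace (X j o\<^sub>L (\<Psi> (?r j i) o\<^sub>L adjoint_op (X i)))"
      by (rule trace_commute[OF Xj tc, symmetric])
    finally show ?thesis
      using has_sum_trace[OF trace_class_compose_left[OF Xj tc] E]
      by (simp add: cinner_adjoint_left[OF Xj])
  qed
  have pos: "positive_matrix n ?r"
    unfolding positive_matrix_def
  proof
    fix y :: "nat \<Rightarrow> 'h"
    define t where "t = (\<Sum>j<n. cinner (x j) (y j))"
    have "(\<Sum>i<n. \<Sum>j<n. cinner (y i) (blinfun_apply (?r i j) (y j))) = (\<Sum>i<n. cinner (y i) (x i)) * t"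
      unfolding t_def sum_product rank_one_apply cinner_scaleC_right
      by (intro sum.cong refl mult.commute)
    also have "(\<Sum>i<n. cinner (y i) (x i)) = cnj t"
      by (simp add: t_def flip: cinner_commute)
    also have "cnj t * t = of_real ((norm t)\<^sup>2)" by (metis complex_norm_square mult.commute)
    finally show "(\<Sum>i<n. \<Sum>j<n. cinner (y i) (blinfun_apply (?r i j) (y j))) \<in> \<real>\<^sub>\<ge>\<^sub>0" by simp
  qed
  then have "positive_matrix n (\<lambda>i j. \<Psi> (?r i j))"
    by (rule completely_positiveD[OF quantum_operation_cp[OF \<Psi>]]) (rule rank_one_trace_class)
  then have "(\<Sum>j<n. \<Sum>i<n. cinner (blinfun_apply (adjoint_op (X j)) e) (blinfun_apply (\<Psi> (?r j i)) (blinfun_apply (adjoint_op (X i)) e))) \<in> \<real>\<^sub>\<ge>\<^sub>0" for e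
    unfolding positive_matrix_def by (elim allE[of _ "\<lambda>i. blinfun_apply (adjoint_op (X i)) e"])
  then have pe: "(\<Sum>i<n. \<Sum>j<n. cinner (blinfun_apply (adjoint_op (X j)) e) (blinfun_apply (\<Psi> (?r j i)) (blinfun_apply (adjoint_op (X i)) e))) \<in> \<real>\<^sub>\<ge>\<^sub>0" for e
    by (subst sum.swap)
  show ?thesis
    by (rule has_sum_nonneg_Reals[OF has_sum_sum[OF _ has_sum_sum[OF _ s]] pe]) auto
qed

section \<open>The multiplicative domain\<close>

text \<open>
  Complete positivity for the row \<open>(A, B\<^sup>*, 1)\<close>. The entry \<open>1\<close> is there to complete squares, as
  in the proof of the Schwarz inequality.
\<close>
lemma dual_map_positive_3:
  assumes \<Psi>: "quantum_operation \<Psi>" and A: "A \<in> bounded_ops" and B: "B \<in> bounded_ops"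
  defines "D \<equiv> dual_map \<Psi>"
  shows "cinner x (blinfun_apply (D (adjoint_op A o\<^sub>L A)) x) + cinner x (blinfun_apply (D (adjoint_op A o\<^sub>L adjoint_op B)) y)
    + cinner x (blinfun_apply (D (adjoint_op A)) z) + cinner y (blinfun_apply (D (B o\<^sub>L A)) x)
    + cinner y (blinfun_apply (D (B o\<^sub>L adjoint_op B)) y) + cinner y (blinfun_apply (D B) z)
    + cinner z (blinfun_apply (D A) x) + cinner z (blinfun_apply (D (adjoint_op B)) y) + cinner z z \<in> \<real>\<^sub>\<ge>\<^sub>0"
proof -
  let ?X = "\<lambda>i::nat. if i = 0 then A else if i = 1 then adjoint_op B else id_blinfun"
  let ?x = "\<lambda>i::nat. if i = 0 then x else if i = 1 then y else z"
  have "?X i \<in> bounded_ops" for i using A B by simp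
  from dual_map_completely_positive[where X = ?X and n = 3 and x = ?x, OF \<Psi> this]
  show ?thesis
    using A B by (simp add: D_def numeral_3_eq_3 adjoint_id dual_map_id[OF \<Psi>] add.assoc)
qed

text \<open>
  Only the reality of the expression in \<open>dual_map_positive_3\<close> is used: it forces the two mixed terms
  of \<open>A\<close> and \<open>1\<close> to be complex conjugates of each other.
\<close>
lemma dual_map_adjoint:
  assumes \<Psi>: "quantum_operation \<Psi>" and A: "A \<in> bounded_ops"
  shows "dual_map \<Psi> (adjoint_op A) = adjoint_op (dual_map \<Psi> A)"
proof -
  let ?D = "dual_map \<Psi>"
  note b = dual_map_bounded[OF \<Psi>]
  have Q: "Im (cinner x (blinfun_apply (?D (adjoint_op A o\<^sub>L A)) x) + cinner x (blinfun_apply (?D (adjoint_op A)) z)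
      + cinner z (blinfun_apply (?D A) x) + cinner z z) = 0" for x z
    using dual_map_positive_3[OF \<Psi> A bounded_ops_closed(6), of x 0 z] by (simp add: complex_nonneg_Reals_iff)
  have zz: "Im (cinner z z) = 0" for z :: 'a by (simp add: cinner_self)
  have xx: "Im (cinner x (blinfun_apply (?D (adjoint_op A o\<^sub>L A)) x)) = 0" for x
    using Q[of x 0] by simp
  have 1: "Im (cinner x (blinfun_apply (?D (adjoint_op A)) z) + cinner z (blinfun_apply (?D A) x)) = 0" for x z
    using Q[of x z] by (simp add: zz xx)
  have "cinner x (blinfun_apply (?D (adjoint_op A)) z) = cnj (cinner z (blinfun_apply (?D A) x))" for x z
    using 1[of x z] 1[of "\<i> *\<^sub>C x" z]
    by (simp add: complex_eq_iff cinner_scaleC_left cinner_scaleC_right bounded_opsD[OF b[OF A]])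
  then have "cinner x (blinfun_apply (?D (adjoint_op A)) z) = cinner (blinfun_apply (?D A) x) z" for x z
    by (simp flip: cinner_commute)
  then show ?thesis
    by (intro op_eqI) (simp add: cinner_adjoint_right[OF b[OF A]])
qed

lemma affine_nonneg_imp_zero:
  assumes "\<And>t. 0 \<le> 2 * Re (t * u) + c"
  shows "u = (0::complex)"
proof (rule ccontr)
  assume "u \<noteq> 0"
  then have n: "(norm u)\<^sup>2 > 0" by simp
  have "0 \<le> 2 * (s * (norm u)\<^sup>2) + c" for s
    using assms[of "of_real s * cnj u"] unfolding cmod_power2 by (simp add: power2_eq_square algebra_simps)
  from this[of "- (\<bar>c\<bar> + 1) / (norm u)\<^sup>2"] show False using n by simp
qed

text \<open>
  Choi's argument. Taking \<open>z = - A x\<close> in \<open>dual_map_positive_3\<close> cancels all terms quadratic in \<open>x\<close>,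
  because \<open>A\<close>, \<open>A\<^sup>*\<close> and \<open>A\<^sup>* A\<close> are fixed. What is left is a nonnegative real affine function of \<open>x\<close>, so its
  linear part, which is the deviation from multiplicativity, is zero.
\<close>
lemma dual_map_multiplicative_domain:
  assumes \<Psi>: "quantum_operation \<Psi>" and A: "A \<in> bounded_ops" and B: "B \<in> bounded_ops"
    and fix1: "dual_map \<Psi> A = A" and fix2: "dual_map \<Psi> (adjoint_op A o\<^sub>L A) = adjoint_op A o\<^sub>L A"
  shows "dual_map \<Psi> (B o\<^sub>L A) = dual_map \<Psi> B o\<^sub>L A"
proof (rule op_eqI)
  let ?D = "dual_map \<Psi>"
  note b = dual_map_bounded[OF \<Psi>]
  fix y x
  define u where "u = cinner y (blinfun_apply (?D (B o\<^sub>L A)) x) - cinner y (blinfun_apply (?D B) (blinfun_apply A x))"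
  define c where "c = Re (cinner y (blinfun_apply (?D (B o\<^sub>L adjoint_op B)) y))"
  have fix3: "?D (adjoint_op A) = adjoint_op A" using dual_map_adjoint[OF \<Psi> A] fix1 by simp
  have BA: "?D (adjoint_op A o\<^sub>L adjoint_op B) = adjoint_op (?D (B o\<^sub>L A))"
    using dual_map_adjoint[OF \<Psi>, of "B o\<^sub>L A"] A B by (simp add: adjoint_compose)
  have "0 \<le> 2 * Re (t * u) + c" for t
  proof -
    let ?x = "t *\<^sub>C x" and ?p = "\<lambda>x. cinner y (blinfun_apply (?D (B o\<^sub>L A)) x)"
      and ?q = "\<lambda>x. cinner y (blinfun_apply (?D B) (blinfun_apply A x))"
    have pq: "?p ?x - ?q ?x = t * u"
      using A B by (simp add: u_def bounded_opsD b cinner_scaleC_right right_diff_distrib)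
    have 1: "cinner ?x (blinfun_apply (?D (adjoint_op A o\<^sub>L adjoint_op B)) y) = cnj (?p ?x)"
      unfolding BA using A B by (simp add: b cinner_adjoint_right flip: cinner_commute)
    have 2: "cinner (blinfun_apply A ?x) (blinfun_apply (?D (adjoint_op B)) y) = cnj (?q ?x)"
      unfolding dual_map_adjoint[OF \<Psi> B] using B by (simp add: b cinner_adjoint_right flip: cinner_commute)
    have "0 \<le> Re (cinner ?x (blinfun_apply (?D (adjoint_op A o\<^sub>L A)) ?x) + cinner ?x (blinfun_apply (?D (adjoint_op A o\<^sub>L adjoint_op B)) y)
      + cinner ?x (blinfun_apply (?D (adjoint_op A)) (- blinfun_apply A ?x)) + ?p ?x
      + cinner y (blinfun_apply (?D (B o\<^sub>L adjoint_op B)) y) + cinner y (blinfun_apply (?D B) (- blinfun_apply A ?x))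
      + cinner (- blinfun_apply A ?x) (blinfun_apply (?D A) ?x) + cinner (- blinfun_apply A ?x) (blinfun_apply (?D (adjoint_op B)) y)
      + cinner (- blinfun_apply A ?x) (- blinfun_apply A ?x))"
      using dual_map_positive_3[OF \<Psi> A B, of ?x y "- blinfun_apply A ?x"] unfolding complex_nonneg_Reals_iff by blast
    also have "\<dots> = Re (cnj (?p ?x) - cnj (?q ?x) + (?p ?x - ?q ?x)) + c"
      unfolding 1 fix1 fix2 fix3 cinner_minus_left 2 c_def
      using cinner_adjoint_right[OF A] by (simp add: blinfun.minus_right)
    also have "\<dots> = 2 * Re (t * u) + c" unfolding pq[symmetric] by simp
    finally show ?thesis .
  qed
  then have "u = 0" by (rule affine_nonneg_imp_zero)
  then show "cinner y (blinfun_apply (?D (B o\<^sub>L A)) x) = cinner y (blinfun_apply (?D B o\<^sub>L A) x)"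
    by (simp add: u_def)
qed

section \<open>Constants and commutation\<close>

text \<open>
  The step from \<open>n = 0\<close> to \<open>n = 1\<close> on the pure states \<open>|u\<rangle>\<langle>u|\<close> already determines the quadratic form
  of \<open>\<Psi>\<^sup>\<sharp>(B) - B\<close>.
\<close>
lemma constant_of_iff_fixed:
  assumes \<Psi>: "quantum_operation \<Psi>" and B: "B \<in> bounded_ops"
  shows "constant_of \<Psi> B \<longleftrightarrow> dual_map \<Psi> B = B"
proof
  assume fixed: "dual_map \<Psi> B = B"
  have "(\<Psi> ^^ m) \<rho> \<in> trace_class \<and> trace ((\<Psi> ^^ m) \<rho> o\<^sub>L B) = trace (\<rho> o\<^sub>L B)" if "\<rho> \<in> trace_class" for m \<rho>
  proof (induction m)
    case (Suc m)
    then show ?case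
      using trace_dual_map[OF \<Psi> B, of "(\<Psi> ^^ m) \<rho>"] quantum_operation_trace_class[OF \<Psi>] by (simp add: fixed)
  qed (use that in simp)
  then show "constant_of \<Psi> B" by (simp add: constant_of_def state_def)
next
  assume const: "constant_of \<Psi> B"
  show "dual_map \<Psi> B = B"
  proof (rule op_eqI_diag[OF dual_map_bounded[OF \<Psi> B] B])
    fix x
    have unit: "cinner u (blinfun_apply (dual_map \<Psi> B) u) = cinner u (blinfun_apply B u)" if "norm u = 1" for u
    proof -
      have "state (rank_one u u)"
        using that by (simp add: state_def positive_rank_one trace_rank_one cinner_self)
      then have "trace ((\<Psi> ^^ 1) (rank_one u u) o\<^sub>L B) = trace ((\<Psi> ^^ 0) (rank_one u u) o\<^sub>L B)"
        using const unfolding constant_of_def by blast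
      then show ?thesis using B by (simp add: cinner_dual_map[OF \<Psi>] trace_rank_one_compose)
    qed
    show "cinner x (blinfun_apply (dual_map \<Psi> B) x) = cinner x (blinfun_apply B x)"
    proof (cases "x = 0")
      case False
      then have "norm ((1 / norm x) *\<^sub>R x) = 1" by simp
      from unit[OF this] False show ?thesis
        by (simp add: blinfun.scaleR_right cinner_scaleR_left cinner_scaleR_right)
    qed simp
  qed
qed

text \<open>
  By cyclicity the two sides of the first commutation relation pair with \<open>S\<close> as the two
  sides of the second one pair with \<open>T\<close>.
\<close>
lemma left_commutes_iff_right_dual_commutes:
  assumes \<Psi>: "quantum_operation \<Psi>" and A: "A \<in> bounded_ops"
  shows "(\<forall>T\<in>trace_class. commutator (left_mult A) \<Psi> T = 0) \<longleftrightarrow>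
    (\<forall>S\<in>bounded_ops. commutator (right_mult A) (dual_map \<Psi>) S = 0)"
proof -
  note b = dual_map_bounded[OF \<Psi>] and tc = quantum_operation_trace_class[OF \<Psi>]
  have 1: "trace ((A o\<^sub>L \<Psi> T) o\<^sub>L S) = trace (T o\<^sub>L dual_map \<Psi> (S o\<^sub>L A))"
    if T: "T \<in> trace_class" and S: "S \<in> bounded_ops" for T S
    using trace_commute[OF A trace_class_compose_right[OF S tc[OF T]]] A S T
    by (simp add: compose_assoc trace_dual_map[OF \<Psi>])
  have 2: "trace (\<Psi> (A o\<^sub>L T) o\<^sub>L S) = trace (T o\<^sub>L (dual_map \<Psi> S o\<^sub>L A))"
    if T: "T \<in> trace_class" and S: "S \<in> bounded_ops" for T S
    using trace_commute[OF A trace_class_compose_right[OF b[OF S] T]] A S T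
    by (simp add: compose_assoc trace_dual_map[OF \<Psi>] trace_class_compose_left)
  show ?thesis
  proof (intro iffI ballI)
    fix S :: "'a operator"
    assume comm: "\<forall>T\<in>trace_class. commutator (left_mult A) \<Psi> T = 0" and S: "S \<in> bounded_ops"
    have "dual_map \<Psi> (S o\<^sub>L A) = dual_map \<Psi> S o\<^sub>L A"
    proof (rule trace_pairing_nondegenerate)
      fix T :: "'a operator" assume T: "T \<in> trace_class"
      have "A o\<^sub>L \<Psi> T = \<Psi> (A o\<^sub>L T)" using comm T by (simp add: commutator_def left_mult_def)
      then show "trace (T o\<^sub>L dual_map \<Psi> (S o\<^sub>L A)) = trace (T o\<^sub>L (dual_map \<Psi> S o\<^sub>L A))"
        using 1[OF T S] 2[OF T S] by simp
    qed (use A S b in auto)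
    then show "commutator (right_mult A) (dual_map \<Psi>) S = 0" by (simp add: commutator_def right_mult_def)
  next
    fix T :: "'a operator"
    assume comm: "\<forall>S\<in>bounded_ops. commutator (right_mult A) (dual_map \<Psi>) S = 0" and T: "T \<in> trace_class"
    have "A o\<^sub>L \<Psi> T = \<Psi> (A o\<^sub>L T)"
    proof (rule trace_pairing_nondegenerate_left)
      fix S :: "'a operator" assume S: "S \<in> bounded_ops"
      have "dual_map \<Psi> S o\<^sub>L A = dual_map \<Psi> (S o\<^sub>L A)" using comm S by (simp add: commutator_def right_mult_def)
      then show "trace ((A o\<^sub>L \<Psi> T) o\<^sub>L S) = trace (\<Psi> (A o\<^sub>L T) o\<^sub>L S)"
        using 1[OF T S] 2[OF T S] by simp
    qed (use A T tc in \<open>simp_all add: trace_class_compose_left\<close>)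
    then show "commutator (left_mult A) \<Psi> T = 0" by (simp add: commutator_def left_mult_def)
  qed
qed

lemma right_dual_commutes_iff_fixed:
  assumes \<Psi>: "quantum_operation \<Psi>" and A: "A \<in> bounded_ops"
  shows "(\<forall>S\<in>bounded_ops. commutator (right_mult A) (dual_map \<Psi>) S = 0) \<longleftrightarrow>
    dual_map \<Psi> A = A \<and> dual_map \<Psi> (adjoint_op A o\<^sub>L A) = adjoint_op A o\<^sub>L A"
proof
  assume "\<forall>S\<in>bounded_ops. commutator (right_mult A) (dual_map \<Psi>) S = 0"
  then have mult: "dual_map \<Psi> (S o\<^sub>L A) = dual_map \<Psi> S o\<^sub>L A" if "S \<in> bounded_ops" for S
    using that by (simp add: commutator_def right_mult_def)
  have A1: "dual_map \<Psi> A = A"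
    using mult[of id_blinfun] by (simp add: dual_map_id[OF \<Psi>])
  then have "dual_map \<Psi> (adjoint_op A o\<^sub>L A) = adjoint_op A o\<^sub>L A"
    using mult[of "adjoint_op A"] A by (simp add: dual_map_adjoint[OF \<Psi> A])
  with A1 show "dual_map \<Psi> A = A \<and> dual_map \<Psi> (adjoint_op A o\<^sub>L A) = adjoint_op A o\<^sub>L A" by simp
next
  assume "dual_map \<Psi> A = A \<and> dual_map \<Psi> (adjoint_op A o\<^sub>L A) = adjoint_op A o\<^sub>L A"
  then show "\<forall>S\<in>bounded_ops. commutator (right_mult A) (dual_map \<Psi>) S = 0"
    by (simp add: commutator_def right_mult_def dual_map_multiplicative_domain[OF \<Psi> A])
qed

theorem theorem5p1:
  fixes \<Psi> :: "'h::chilbert_space operator \<Rightarrow> 'h operator"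
    and A :: "'h operator"
  assumes "quantum_operation \<Psi>"
    and "A \<in> bounded_ops"
  shows
    "((\<forall>T\<in>trace_class. commutator (left_mult A) \<Psi> T = 0) \<longleftrightarrow>
      constant_of \<Psi> A \<and> constant_of \<Psi> (adjoint_op A o\<^sub>L A)) \<and>
     (constant_of \<Psi> A \<and> constant_of \<Psi> (adjoint_op A o\<^sub>L A) \<longleftrightarrow>
      (\<forall>S\<in>bounded_ops. commutator (right_mult A) (dual_map \<Psi>) S = 0)) \<and>
     ((\<forall>S\<in>bounded_ops. commutator (right_mult A) (dual_map \<Psi>) S = 0) \<longleftrightarrow>
      dual_map \<Psi> A = A \<and>
      dual_map \<Psi> (adjoint_op A o\<^sub>L A) = adjoint_op A o\<^sub>L A)"
proof -
  have "constant_of \<Psi> A \<longleftrightarrow> dual_map \<Psi> A = A"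
    and "constant_of \<Psi> (adjoint_op A o\<^sub>L A) \<longleftrightarrow> dual_map \<Psi> (adjoint_op A o\<^sub>L A) = adjoint_op A o\<^sub>L A"
    using assms by (simp_all add: constant_of_iff_fixed)
  then show ?thesis
    using left_commutes_iff_right_dual_commutes[OF assms] right_dual_commutes_iff_fixed[OF assms] by blast
qed

end
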